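(* Let $d=2$. Almost surely there is no bi-infinite path in the perturbed directed spanning forest, i.e. almost surely there is no sequence $(x_k)_{k\in\mathbb{Z}}$ of points of $V$ with $h(x_k)=x_{k+1}$ for all $k\in\mathbb{Z}$.
   Context: Let $\{U_{w}: w\in\mathbb{Z}^2\}$ be i.i.d. random variables uniformly distributed on $[-1,1]^2$, and $V:=\{w+U_w : w\in\mathbb{Z}^2\}$. For $x\in\mathbb{R}^2$ let $h(x):=\operatorname{argmin}\{\|y-x\|_1 : y\in V,\ y(2)>x(2)\}$, which is a.s. well defined and unique. The perturbed directed spanning forest is the graph with vertex set $V$ and edges $\langle x,h(x)\rangle$, $x\in V$. *)

theory Defs
  imports "HOL-Probability.Probability"
begin

definition l1_norm :: "real ^ 2 \<Rightarrow> real" where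
  "l1_norm x = (\<Sum>i\<in>UNIV. \<bar>x $ i\<bar>)"

definition lattice_point :: "int ^ 2 \<Rightarrow> real ^ 2" where
  "lattice_point w = (\<chi> i. of_int (w $ i))"

definition perturbed_lattice :: "(int ^ 2 \<Rightarrow> real ^ 2) \<Rightarrow> (real ^ 2) set" where
  "perturbed_lattice u = {lattice_point w + u w | w. True}"

text \<open>If the minimum is not attained, or is attained more than once, \<open>ARG_MIN\<close> still denotes some
  arbitrary point. For the random vertex set below this happens with probability zero.\<close>

definition dsf_next :: "(real ^ 2) set \<Rightarrow> real ^ 2 \<Rightarrow> real ^ 2" where
  "dsf_next V x = (ARG_MIN (\<lambda>y. l1_norm (y - x)) y. y \<in> V \<and> y $ 2 > x $ 2)"

definition bi_infinite_path :: "(real ^ 2) set \<Rightarrow> (int \<Rightarrow> real ^ 2) \<Rightarrow> bool" where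
  "bi_infinite_path V x \<longleftrightarrow> (\<forall>k. x k \<in> V \<and> dsf_next V (x k) = x (k + 1))"

definition iid_uniform_perturbations ::
    "'a measure \<Rightarrow> (int ^ 2 \<Rightarrow> 'a \<Rightarrow> real ^ 2) \<Rightarrow> bool" where
  "iid_uniform_perturbations M U \<longleftrightarrow>
     prob_space.indep_vars M (\<lambda>_. borel) U UNIV \<and>
     (\<forall>w. distr M borel (U w) = uniform_measure lborel (cbox (\<chi> i. -1) (\<chi> i. 1)))"

end

theory Submission imports Defs begin

text \<open>Call a vertex immortal if it has ancestors of every order; every vertex of a bi-infinite path is
  immortal. By mass transport, a translation-invariant field of immortal vertices cannot merge: each
  immortal vertex sends mass one to its successor, which is again immortal, so an immortal vertex has
  on average, hence almost surely, exactly one immortal parent.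

  On the other hand, if immortal vertices had positive probability, one could force two of them to
  merge. The displacements are bounded, so edges have bounded length and whether a vertex of row 0 is
  immortal depends only on the rows up to 9. In these rows there are almost surely vertical \<open>walls\<close>
  arbitrarily far to the left and to the right that no path can cross, so with positive probability
  two immortal vertices of row 0 are separated by a wall and enclosed by two further ones. Since a
  wall separates them, neither is an ancestor of the other. Independently, the rows 10 to 12 may form
  a \<open>lid\<close> over the enclosure: a slightly ascending row of vertices that the enclosed paths cannot jump
  over, and along which every path that has hit it moves step by step to the right. Both paths then
  run into the same vertex.\<close>

section \<open>The forest on lattice sites\<close>

text \<open>Clipping changes the configuration only on a null set, but makes the bound on the displacements
  available for every configuration, so that locality holds surely.\<close>

definition clip :: "real \<Rightarrow> real" where
  "clip r = max (-1) (min 1 r)"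

definition horiz :: "(int ^ 2 \<Rightarrow> real ^ 2) \<Rightarrow> int ^ 2 \<Rightarrow> real" where
  "horiz u w = of_int (w $ 1) + clip (u w $ 1)"

definition altitude :: "(int ^ 2 \<Rightarrow> real ^ 2) \<Rightarrow> int ^ 2 \<Rightarrow> real" where
  "altitude u w = of_int (w $ 2) + clip (u w $ 2)"

definition gap :: "(int ^ 2 \<Rightarrow> real ^ 2) \<Rightarrow> int ^ 2 \<Rightarrow> int ^ 2 \<Rightarrow> real" where
  "gap u v w = \<bar>horiz u w - horiz u v\<bar> + \<bar>altitude u w - altitude u v\<bar>"

text \<open>Strict minimality: a tie for the nearest higher site leaves \<open>v\<close> without
  successor, so uniqueness (\<open>succ_unique\<close>) holds in every configuration and not just
  almost surely.\<close>

definition succ :: "(int ^ 2 \<Rightarrow> real ^ 2) \<Rightarrow> int ^ 2 \<Rightarrow> int ^ 2 \<Rightarrow> bool" where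
  "succ u v w \<longleftrightarrow> altitude u v < altitude u w \<and>
     (\<forall>w'. w' \<noteq> w \<longrightarrow> altitude u v < altitude u w' \<longrightarrow> gap u v w < gap u v w')"

text \<open>Demanded of all pairs of sites, wherever they lie relative to \<open>v\<close>; in this
  form it also excludes coinciding vertices.\<close>

definition no_ties :: "(int ^ 2 \<Rightarrow> real ^ 2) \<Rightarrow> bool" where
  "no_ties u \<longleftrightarrow> (\<forall>v w w'. v \<noteq> w \<longrightarrow> v \<noteq> w' \<longrightarrow> w \<noteq> w' \<longrightarrow> gap u v w \<noteq> gap u v w')"

primrec has_ancestor :: "nat \<Rightarrow> (int ^ 2 \<Rightarrow> real ^ 2) \<Rightarrow> int ^ 2 \<Rightarrow> bool" where
  "has_ancestor 0 u w \<longleftrightarrow> True"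
| "has_ancestor (Suc n) u w \<longleftrightarrow> (\<exists>v. succ u v w \<and> has_ancestor n u v)"

text \<open>Stated through finite orders, hence a countable intersection of measurable events;
  \<open>immortal_parent\<close> recovers infinite backward chains.\<close>

definition immortal :: "(int ^ 2 \<Rightarrow> real ^ 2) \<Rightarrow> int ^ 2 \<Rightarrow> bool" where
  "immortal u w \<longleftrightarrow> (\<forall>n. has_ancestor n u w)"

abbreviation site :: "int \<Rightarrow> int \<Rightarrow> int ^ 2" where
  "site i j \<equiv> vector [i, j]"

section \<open>Bounds on positions and edge lengths; existence of successors\<close>

lemma site_eq_iff: "site i j = w \<longleftrightarrow> i = w $ 1 \<and> j = w $ 2"
  by (auto simp: vec_eq_iff forall_2)

lemma clip_bounds: "-1 \<le> clip r" "clip r \<le> 1"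
  by (auto simp: clip_def)

lemma clip_eq: "-1 \<le> r \<Longrightarrow> r \<le> 1 \<Longrightarrow> clip r = r"
  by (auto simp: clip_def)

lemma horiz_bounds: "of_int (w $ 1) - 1 \<le> horiz u w" "horiz u w \<le> of_int (w $ 1) + 1"
  using clip_bounds[of "u w $ 1"] by (auto simp: horiz_def)

lemma altitude_bounds: "of_int (w $ 2) - 1 \<le> altitude u w" "altitude u w \<le> of_int (w $ 2) + 1"
  using clip_bounds[of "u w $ 2"] by (auto simp: altitude_def)

lemma succ_altitude: "succ u v w \<Longrightarrow> altitude u v < altitude u w"
  by (simp add: succ_def)

lemma succ_unique: "succ u v w \<Longrightarrow> succ u v w' \<Longrightarrow> w = w'"
  unfolding succ_def by (metis less_asym)

lemma succ_gap_le: "succ u v w \<Longrightarrow> altitude u v < altitude u w' \<Longrightarrow> gap u v w \<le> gap u v w'"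
  unfolding succ_def by (cases "w' = w") auto

lemma succ_eqI:
  "succ u v w \<Longrightarrow> altitude u v < altitude u w' \<Longrightarrow> gap u v w' \<le> gap u v w \<Longrightarrow> w' = w"
  unfolding succ_def by (meson not_le)

text \<open>Two displacements change a coordinate difference by at most 2. The site three rows up is
  therefore higher by at least 1 and at most 5, and at most 2 away horizontally, whence 7 = 5 +
  2.\<close>

lemma ex_near_higher: "\<exists>w. altitude u v < altitude u w \<and> gap u v w \<le> 7"
proof (intro exI conjI)
  let ?w = "site (v $ 1) (v $ 2 + 3)"
  show "altitude u v < altitude u ?w"
    using altitude_bounds[where w = v and u = u] altitude_bounds[where w = ?w and u = u] by simp
  show "gap u v ?w \<le> 7"
    using altitude_bounds[where w = v and u = u] altitude_bounds[where w = ?w and u = u] horiz_bounds[where w = v and u = u] horiz_bounds[where w = ?w and u = u]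
    by (simp add: gap_def abs_if)
qed

lemma succ_gap_le_7: "succ u v w \<Longrightarrow> gap u v w \<le> 7"
  using ex_near_higher[of u v] succ_gap_le by (metis order_trans)

text \<open>The radius 9 is the edge bound 7 plus 2 for the displacements of both endpoints.\<close>

definition nearby :: "int ^ 2 \<Rightarrow> (int ^ 2) set" where
  "nearby v = {w. \<bar>w $ 1 - v $ 1\<bar> \<le> 9 \<and> \<bar>w $ 2 - v $ 2\<bar> \<le> 9}"

lemma finite_rectangle: "finite {w :: int ^ 2. a \<le> w $ 1 \<and> w $ 1 \<le> b \<and> c \<le> w $ 2 \<and> w $ 2 \<le> d}"
proof (rule finite_subset)
  show "{w :: int ^ 2. a \<le> w $ 1 \<and> w $ 1 \<le> b \<and> c \<le> w $ 2 \<and> w $ 2 \<le> d}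
          \<subseteq> (\<lambda>(i, j). site i j) ` ({a..b} \<times> {c..d})"
  proof
    fix w :: "int ^ 2"
    assume "w \<in> {w. a \<le> w $ 1 \<and> w $ 1 \<le> b \<and> c \<le> w $ 2 \<and> w $ 2 \<le> d}"
    moreover have "w = (\<lambda>(i, j). site i j) (w $ 1, w $ 2)"
      by (simp add: vec_eq_iff forall_2)
    ultimately show "w \<in> (\<lambda>(i, j). site i j) ` ({a..b} \<times> {c..d})"
      by (intro image_eqI[where x = "(w $ 1, w $ 2)"]) auto
  qed
qed simp

lemma finite_nearby: "finite (nearby v)"
  by (rule finite_subset[OF _ finite_rectangle[of "v $ 1 - 9" "v $ 1 + 9" "v $ 2 - 9" "v $ 2 + 9"]])
    (auto simp: nearby_def)

lemma nearby_sym: "w \<in> nearby v \<longleftrightarrow> v \<in> nearby w"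
  by (auto simp: nearby_def abs_minus_commute)

lemma gap_le_7_nearby:
  assumes "gap u v w \<le> 7"
  shows "w \<in> nearby v"
proof -
  have "\<bar>horiz u w - horiz u v\<bar> \<le> 7" "\<bar>altitude u w - altitude u v\<bar> \<le> 7"
    using assms by (auto simp: gap_def)
  then have "\<bar>of_int (w $ 1) - of_int (v $ 1)\<bar> \<le> (9 :: real)"
    "\<bar>of_int (w $ 2) - of_int (v $ 2)\<bar> \<le> (9 :: real)"
    using altitude_bounds[where w = v and u = u] altitude_bounds[where w = w and u = u] horiz_bounds[where w = v and u = u] horiz_bounds[where w = w and u = u]
    by (auto simp: abs_le_iff)
  then show ?thesis
    unfolding nearby_def by (auto simp: abs_le_iff)
qed

lemmas succ_nearby = gap_le_7_nearby[OF succ_gap_le_7]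

text \<open>Only the finitely many higher sites within distance 7 compete, so a minimum exists;
  \<open>no_ties\<close> makes it strict.\<close>

lemma ex_succ:
  assumes "no_ties u"
  shows "\<exists>w. succ u v w"
proof -
  let ?C = "{w. altitude u v < altitude u w \<and> gap u v w \<le> 7}"
  have fin: "finite ?C"
    by (rule finite_subset[OF _ finite_nearby[of v]]) (auto intro: gap_le_7_nearby)
  have ne: "?C \<noteq> {}"
    using ex_near_higher[of u v] by auto
  define w where "w = arg_min_on (gap u v) ?C"
  have w: "w \<in> ?C" "\<And>w'. w' \<in> ?C \<Longrightarrow> gap u v w \<le> gap u v w'"
    using arg_min_if_finite(1)[OF fin ne] arg_min_least[OF fin ne] unfolding w_def by blast+
  have "succ u v w"
    unfolding succ_def
  proof (intro conjI allI impI)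
    show "altitude u v < altitude u w" using w(1) by simp
    fix w' assume *: "w' \<noteq> w" "altitude u v < altitude u w'"
    then have "gap u v w \<noteq> gap u v w'"
      using assms w(1) unfolding no_ties_def by (metis (mono_tags) less_irrefl mem_Collect_eq)
    moreover have "gap u v w \<le> gap u v w'"
      using w * by (cases "gap u v w' \<le> 7") auto
    ultimately show "gap u v w < gap u v w'" by simp
  qed
  then show ?thesis ..
qed

section \<open>Ancestors, immortal sites and merging of paths\<close>

lemma has_ancestor_mono: "has_ancestor (Suc n) u w \<Longrightarrow> has_ancestor n u w"
  by (induction n arbitrary: w) auto

lemma has_ancestor_antimono: "m \<le> n \<Longrightarrow> has_ancestor n u w \<Longrightarrow> has_ancestor m u w"
  by (induction n rule: dec_induct) (blast dest: has_ancestor_mono)+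

lemma immortal_succ: "immortal u v \<Longrightarrow> succ u v w \<Longrightarrow> immortal u w"
  unfolding immortal_def
proof
  fix n assume "\<forall>n. has_ancestor n u v" "succ u v w"
  then have "has_ancestor (Suc n) u w" by auto
  then show "has_ancestor n u w" by (rule has_ancestor_mono)
qed

lemma immortal_rtranclp: "(succ u)\<^sup>*\<^sup>* v w \<Longrightarrow> immortal u v \<Longrightarrow> immortal u w"
  by (induction rule: rtranclp_induct) (auto intro: immortal_succ)

text \<open>Koenig's argument: all parents of \<open>w\<close> lie in the finite set
  \<open>nearby w\<close>. If the ancestry of each parent were bounded, so would be that of
  \<open>w\<close>.\<close>

lemma immortal_parent:
  assumes "immortal u w"
  shows "\<exists>v. immortal u v \<and> succ u v w"
proof (rule ccontr)
  assume *: "\<not> ?thesis"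
  have "\<exists>n. \<not> has_ancestor n u v" if "succ u v w" for v
    using * that by (auto simp: immortal_def)
  then obtain N where N: "\<And>v. succ u v w \<Longrightarrow> \<not> has_ancestor (N v) u v"
    by metis
  \<comment> \<open>The sum serves as a common upper bound for the \<open>N v\<close>.\<close>
  have "has_ancestor (Suc (\<Sum>v\<in>nearby w. N v)) u w"
    using assms by (simp add: immortal_def del: has_ancestor.simps)
  then obtain v where v: "succ u v w" "has_ancestor (\<Sum>v\<in>nearby w. N v) u v"
    by auto
  have "v \<in> nearby w"
    using succ_nearby[OF v(1)] by (simp add: nearby_sym)
  then have "N v \<le> (\<Sum>v\<in>nearby w. N v)"
    by (intro member_le_sum) (auto simp: finite_nearby)
  with v have "has_ancestor (N v) u v"
    by (auto intro: has_ancestor_antimono)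
  with N v show False by auto
qed

text \<open>Walk back from \<open>t\<close>: either the last edges of the two paths differ, and
  \<open>z\<close> is found, or they start at the same point, which replaces \<open>t\<close>. The
  last two hypotheses prevent either path from being used up first.\<close>

lemma merging_paths:
  assumes "r\<^sup>*\<^sup>* p t" "r\<^sup>*\<^sup>* q t" "\<not> r\<^sup>*\<^sup>* p q" "\<not> r\<^sup>*\<^sup>* q p"
  shows "\<exists>z v w. v \<noteq> w \<and> r v z \<and> r w z \<and> r\<^sup>*\<^sup>* p v \<and> r\<^sup>*\<^sup>* q w"
  using assms(1,2)
proof (induction rule: rtranclp_induct)
  case base
  with assms show ?case by simp
next
  case (step t' t)
  from step.prems show ?case
  proof (cases rule: rtranclp.cases)
    case rtrancl_refl
    with step assms(3) show ?thesis by (metis rtranclp.rtrancl_into_rtrancl)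
  next
    case (rtrancl_into_rtrancl t'')
    show ?thesis
    proof (cases "t'' = t'")
      case True
      with rtrancl_into_rtrancl(1) show ?thesis by (intro step.IH) simp
    next
      case False
      then show ?thesis using step.hyps rtrancl_into_rtrancl by metis
    qed
  qed
qed

section \<open>Immortality in row 0 depends only on rows up to 9\<close>

lemma rows_le_cong:
  assumes "\<And>w. w $ 2 \<le> 9 \<Longrightarrow> u w = u' w" "w $ 2 \<le> 9"
  shows "horiz u w = horiz u' w" "altitude u w = altitude u' w"
  using assms by (auto simp: horiz_def altitude_def)

text \<open>A site above row 9 has altitude at least 9, hence distance at least 8 from
  \<open>v\<close>, whose altitude is at most 1; an edge has length at most 7. So rows above 9
  cannot compete.\<close>

lemma succ_rows_le:
  assumes agree: "\<And>w. w $ 2 \<le> 9 \<Longrightarrow> u w = u' w"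
    and "succ u v w" "altitude u w \<le> 1"
  shows "succ u' v w"
proof -
  note eq = rows_le_cong[OF agree]
  have vw: "altitude u v < altitude u w" using assms(2) by (rule succ_altitude)
  have w: "w $ 2 \<le> 9" and v: "v $ 2 \<le> 9"
    using assms(3) vw altitude_bounds[where w = w and u = u] altitude_bounds[where w = v and u = u] by linarith+
  have gapvw: "gap u' v w = gap u v w"
    using v w by (simp add: gap_def eq)
  show ?thesis
    unfolding succ_def
  proof (intro conjI allI impI)
    show "altitude u' v < altitude u' w" using vw v w by (simp add: eq)
    fix w' assume *: "w' \<noteq> w" "altitude u' v < altitude u' w'"
    show "gap u' v w < gap u' v w'"
    proof (cases "w' $ 2 \<le> 9")
      case True
      then have "altitude u v < altitude u w'" "gap u' v w' = gap u v w'"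
        using * v by (simp_all add: eq gap_def)
      with * assms(2) show ?thesis by (simp add: gapvw succ_def)
    next
      case False
      then have "altitude u' w' \<ge> 9" using altitude_bounds[where w = w' and u = u'] by linarith
      moreover have "altitude u' v \<le> 1" using vw assms(3) v by (simp add: eq[symmetric])
      ultimately have "gap u' v w' \<ge> 8" by (simp add: gap_def)
      then show ?thesis using succ_gap_le_7[OF assms(2)] gapvw by simp
    qed
  qed
qed

lemma has_ancestor_rows_le:
  assumes agree: "\<And>w. w $ 2 \<le> 9 \<Longrightarrow> u w = u' w"
    and "has_ancestor n u w" "altitude u w \<le> 1"
  shows "has_ancestor n u' w"
  using assms(2,3)
proof (induction n arbitrary: w)
  case (Suc n)
  then obtain v where v: "succ u v w" "has_ancestor n u v" by auto
  moreover have "altitude u v \<le> 1" using succ_altitude[OF v(1)] Suc.prems by simp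
  ultimately have "succ u' v w" "has_ancestor n u' v"
    using Suc succ_rows_le[OF agree] by auto
  then show ?case by auto
qed simp

lemma immortal_rows_le:
  assumes agree: "\<And>w. w $ 2 \<le> 9 \<Longrightarrow> u w = u' w" and "w $ 2 = 0"
  shows "immortal u w \<longleftrightarrow> immortal u' w"
proof -
  have "altitude u w \<le> 1" "altitude u' w \<le> 1"
    using altitude_bounds(2)[where w = w] assms(2) by (metis add_0 of_int_0)+
  then have "has_ancestor n u w \<longleftrightarrow> has_ancestor n u' w" for n
    using has_ancestor_rows_le[of u u' n w] has_ancestor_rows_le[of u' u n w] agree by auto
  then show ?thesis by (simp add: immortal_def)
qed

section \<open>Walls, the lid and the merging of enclosed paths\<close>

text \<open>Common form of walls and lids: an event on the coordinates in \<open>S\<close> only, of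
  positive probability when \<open>S\<close> is finite and the boxes around \<open>c\<close> fit
  into the square.\<close>

definition near :: "(int ^ 2) set \<Rightarrow> (int ^ 2 \<Rightarrow> real ^ 2) \<Rightarrow> real \<Rightarrow> (int ^ 2 \<Rightarrow> real ^ 2) \<Rightarrow> bool" where
  "near S c \<rho> u \<longleftrightarrow> (\<forall>w\<in>S. \<bar>u w $ 1 - c w $ 1\<bar> < \<rho> \<and> \<bar>u w $ 2 - c w $ 2\<bar> < \<rho>)"

lemma near_horiz:
  assumes "near S c \<rho> u" "w \<in> S" "\<bar>c w $ 1\<bar> + \<rho> \<le> 1"
  shows "\<bar>horiz u w - (of_int (w $ 1) + c w $ 1)\<bar> < \<rho>"
proof -
  have *: "\<bar>u w $ 1 - c w $ 1\<bar> < \<rho>" using assms by (auto simp: near_def)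
  then have "-1 \<le> u w $ 1" "u w $ 1 \<le> 1" using assms(3) by linarith+
  then show ?thesis using * by (simp add: horiz_def clip_eq)
qed

lemma near_altitude:
  assumes "near S c \<rho> u" "w \<in> S" "\<bar>c w $ 2\<bar> + \<rho> \<le> 1"
  shows "\<bar>altitude u w - (of_int (w $ 2) + c w $ 2)\<bar> < \<rho>"
proof -
  have *: "\<bar>u w $ 2 - c w $ 2\<bar> < \<rho>" using assms by (auto simp: near_def)
  then have "-1 \<le> u w $ 2" "u w $ 2 \<le> 1" using assms(3) by linarith+
  then show ?thesis using * by (simp add: altitude_def clip_eq)
qed

text \<open>In a wall the columns \<open>K\<close> and \<open>K + 1\<close> are pushed apart, and their neighbours away from the gap.
  Jumping over the gap then costs more than climbing to the next rung of the nearer column.\<close>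

definition wall_sites :: "int \<Rightarrow> (int ^ 2) set" where
  "wall_sites K = {w. K - 1 \<le> w $ 1 \<and> w $ 1 \<le> K + 2 \<and> -1 \<le> w $ 2 \<and> w $ 2 \<le> 9}"

definition wall_offset :: "int \<Rightarrow> int ^ 2 \<Rightarrow> real ^ 2" where
  "wall_offset K w = vector [if w $ 1 = K - 1 then - 1/2 else if w $ 1 = K then - 7/8
      else if w $ 1 = K + 1 then 7/8 else 1/2, 0]"

definition wall :: "int \<Rightarrow> (int ^ 2 \<Rightarrow> real ^ 2) \<Rightarrow> bool" where
  "wall K = near (wall_sites K) (wall_offset K) (1/8)"

lemma wall_offset_le: "\<bar>wall_offset K w $ 1\<bar> \<le> 7/8" "\<bar>wall_offset K w $ 2\<bar> \<le> 7/8"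
  by (auto simp: wall_offset_def)

text \<open>With \<open>wall_right\<close>: rows -1 to 9 leave the strip between
  \<open>K - 3/4\<close> and \<open>K + 7/4\<close>, of width 5/2, empty. The bounds are the offsets
  7/8 reduced by the tolerance 1/8; columns further out cannot reach the strip anyway.\<close>

lemma wall_left:
  assumes "wall K u" "-1 \<le> w $ 2" "w $ 2 \<le> 9" "w $ 1 \<le> K"
  shows "horiz u w \<le> of_int K - 3/4"
proof (cases "w \<in> wall_sites K")
  case True
  have "\<bar>horiz u w - (of_int (w $ 1) + wall_offset K w $ 1)\<bar> < 1/8"
    by (rule near_horiz[OF assms(1)[unfolded wall_def] True])
      (use wall_offset_le(1)[of K w] in linarith)
  moreover have "w $ 1 = K - 1 \<or> w $ 1 = K" using True assms by (auto simp: wall_sites_def)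
  moreover have "of_int (w $ 1) + wall_offset K w $ 1 \<le> of_int K - 7/8"
    using calculation(2) by (auto simp: wall_offset_def)
  ultimately show ?thesis by linarith
next
  case False
  then have "w $ 1 \<le> K - 2" using assms by (auto simp: wall_sites_def)
  then show ?thesis using horiz_bounds[where w = w and u = u] by linarith
qed

lemma wall_right:
  assumes "wall K u" "-1 \<le> w $ 2" "w $ 2 \<le> 9" "K + 1 \<le> w $ 1"
  shows "of_int K + 7/4 \<le> horiz u w"
proof (cases "w \<in> wall_sites K")
  case True
  have "\<bar>horiz u w - (of_int (w $ 1) + wall_offset K w $ 1)\<bar> < 1/8"
    by (rule near_horiz[OF assms(1)[unfolded wall_def] True])
      (use wall_offset_le(1)[of K w] in linarith)
  moreover have "w $ 1 = K + 1 \<or> w $ 1 = K + 2" using True assms by (auto simp: wall_sites_def)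
  moreover have "of_int K + 15/8 \<le> of_int (w $ 1) + wall_offset K w $ 1"
    using calculation(2) by (auto simp: wall_offset_def)
  ultimately show ?thesis by linarith
next
  case False
  then have "w $ 1 \<ge> K + 3" using assms by (auto simp: wall_sites_def)
  then show ?thesis using horiz_bounds[where w = w and u = u] by linarith
qed

text \<open>Each column has a site within 1/8 of every integer altitude up to 9; the rung taken is
  the first integer above \<open>h + 1/8\<close>. The bound 35/4 keeps it within row 9.\<close>

lemma wall_rung_above:
  assumes "wall K u" "-1 \<le> h" "h < 35/4" "k = K \<or> k = K + 1"
  shows "\<exists>w. w $ 1 = k \<and> -1 \<le> w $ 2 \<and> w $ 2 \<le> 9 \<and> h < altitude u w \<and> altitude u w < h + 5/4"
proof -
  let ?r = "\<lfloor>h + 1/8\<rfloor> + 1"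
  have r: "of_int ?r > h + 1/8" "of_int ?r \<le> h + 9/8" by linarith+
  have r_bounds: "0 \<le> ?r" "?r \<le> 9" using assms(2,3) by linarith+
  let ?w = "site k ?r"
  have w: "?w \<in> wall_sites K" using assms(4) r_bounds by (auto simp: wall_sites_def)
  have "\<bar>altitude u ?w - (of_int (?w $ 2) + wall_offset K ?w $ 2)\<bar> < 1/8"
    by (rule near_altitude[OF assms(1)[unfolded wall_def] w])
      (use wall_offset_le(2)[of K ?w] in linarith)
  then have "\<bar>altitude u ?w - of_int ?r\<bar> < 1/8" by (simp add: wall_offset_def)
  then have "h < altitude u ?w" "altitude u ?w < h + 5/4" using r by linarith+
  then show ?thesis using r_bounds by (intro exI[of _ ?w]) auto
qed

text \<open>The rung \<open>s\<close> of column \<open>K\<close> is less than 5/4 higher than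
  \<open>v\<close> and lies in a band of width 1/4 next to the strip. Reaching it is cheaper than
  crossing the strip, which alone costs 5/2.\<close>

lemma wall_blocks_right:
  assumes "wall K u" "succ u v w" "horiz u v \<le> of_int K - 3/4" "of_int K + 7/4 \<le> horiz u w"
    "-1 \<le> altitude u v" "altitude u v < 35/4"
  shows False
proof -
  obtain s where s: "s $ 1 = K" "-1 \<le> s $ 2" "s $ 2 \<le> 9" "altitude u v < altitude u s"
      "altitude u s < altitude u v + 5/4"
    using wall_rung_above[OF assms(1,5,6)] by blast
  have "of_int K - 1 \<le> horiz u s" "horiz u s \<le> of_int K - 3/4"
    using wall_left[OF assms(1) s(2,3)] horiz_bounds[where w = s and u = u] s(1) by auto
  then have "gap u v s < gap u v w" using s assms(3,4) by (simp add: gap_def)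
  with succ_gap_le[OF assms(2) s(4)] show False by simp
qed

lemma wall_blocks_left:
  assumes "wall K u" "succ u v w" "of_int K + 7/4 \<le> horiz u v" "horiz u w \<le> of_int K - 3/4"
    "-1 \<le> altitude u v" "altitude u v < 35/4"
  shows False
proof -
  obtain s where s: "s $ 1 = K + 1" "-1 \<le> s $ 2" "s $ 2 \<le> 9" "altitude u v < altitude u s"
      "altitude u s < altitude u v + 5/4"
    using wall_rung_above[OF assms(1,5,6), of "K + 1"] by blast
  have "of_int K + 2 \<ge> horiz u s" "horiz u s \<ge> of_int K + 7/4"
    using wall_right[OF assms(1) s(2,3)] horiz_bounds[where w = s and u = u] s(1) by auto
  then have "gap u v s < gap u v w" using s assms(3,4) by (simp add: gap_def)
  with succ_gap_le[OF assms(2) s(4)] show False by simp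
qed

lemma low_row:
  assumes "-1 \<le> altitude u v" "succ u v w" "altitude u w \<le> 1"
  shows "-1 \<le> w $ 2" "w $ 2 \<le> 9"
  using assms(1,3) succ_altitude[OF assms(2)] altitude_bounds[where w = w and u = u] by linarith+

text \<open>Altitudes increase along the path, so all of it stays between -1 and 1, where the wall
  blocks every step to the other side.\<close>

lemma wall_separates:
  assumes "wall K u" "(succ u)\<^sup>*\<^sup>* v w" "altitude u w \<le> 1" "v $ 2 = 0"
  shows "v $ 1 \<le> K \<longleftrightarrow> w $ 1 \<le> K"
proof -
  have "-1 \<le> w $ 2 \<and> w $ 2 \<le> 9 \<and> -1 \<le> altitude u w \<and> (v $ 1 \<le> K \<longleftrightarrow> w $ 1 \<le> K)"
    using assms(2,3)
  proof (induction rule: rtranclp_induct)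
    case base
    then show ?case using assms(4) altitude_bounds[where w = v and u = u] by auto
  next
    case (step s t)
    have st: "altitude u s < altitude u t" using step(2) by (rule succ_altitude)
    then have IH: "-1 \<le> s $ 2" "s $ 2 \<le> 9" "-1 \<le> altitude u s" "v $ 1 \<le> K \<longleftrightarrow> s $ 1 \<le> K"
      using step by auto
    have t: "-1 \<le> t $ 2" "t $ 2 \<le> 9"
      using low_row[OF IH(3) step(2) step.prems] by auto
    have s_low: "altitude u s < 35/4" using st step.prems by simp
    have "s $ 1 \<le> K \<longleftrightarrow> t $ 1 \<le> K"
    proof (rule ccontr)
      assume neq: "\<not> ?thesis"
      show False
      proof (cases "s $ 1 \<le> K")
        case True
        with neq have "K + 1 \<le> t $ 1" by simp
        then show False
          using wall_blocks_right[OF assms(1) step(2) _ _ IH(3) s_low]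
            wall_left[OF assms(1) IH(1,2) True] wall_right[OF assms(1) t] by simp
      next
        case False
        with neq have "K + 1 \<le> s $ 1" "t $ 1 \<le> K" by simp_all
        then show False
          using wall_blocks_left[OF assms(1) step(2) _ _ IH(3) s_low]
            wall_right[OF assms(1) IH(1,2)] wall_left[OF assms(1) t] by simp
      qed
    qed
    then show ?case using t IH st by auto
  qed
  then show ?thesis by simp
qed

text \<open>Row 11 is the ramp. Row 10 is pushed below it, and out of the gaps of the walls in the columns
  \<open>L\<close> and \<open>R\<close>; row 12 is pushed up, so that a jump over the ramp is longer than one onto it.\<close>

definition lid_sites :: "int \<Rightarrow> int \<Rightarrow> (int ^ 2) set" where
  "lid_sites L R = {w. L - 5 \<le> w $ 1 \<and> w $ 1 \<le> R + 6 \<and> 10 \<le> w $ 2 \<and> w $ 2 \<le> 12}"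

text \<open>Chosen such that the whole ramp, over \<open>R - L + 12\<close> columns, rises by less
  than 1/2.\<close>

definition ramp_slope :: "int \<Rightarrow> int \<Rightarrow> real" where
  "ramp_slope L R = 1 / (2 * of_int (R - L + 14))"

text \<open>In row 10 the columns \<open>L + 1\<close> and \<open>L + 2\<close> go right to clear
  the gap at \<open>L\<close>. From \<open>L + 3\<close> on, a push to the left still ends right of
  that gap, and it keeps the columns up to \<open>R\<close> left of the gap at
  \<open>R\<close>.\<close>

definition lid_offset :: "int \<Rightarrow> int \<Rightarrow> int ^ 2 \<Rightarrow> real ^ 2" where
  "lid_offset L R w = vector
     [if w $ 2 \<noteq> 10 then 0 else if w $ 1 \<le> L \<or> L + 2 < w $ 1 \<and> w $ 1 \<le> R then - 7/8 else 7/8,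
      if w $ 2 = 10 then - 1/2
      else if w $ 2 = 11 then ramp_slope L R * of_int (w $ 1 - L + 6) - 1 else 1/2]"

text \<open>With a quarter of the slope as tolerance, the errors of two neighbouring ramp sites add
  up to less than half the rise between them, so the ramp remains increasing.\<close>

definition lid :: "int \<Rightarrow> int \<Rightarrow> (int ^ 2 \<Rightarrow> real ^ 2) \<Rightarrow> bool" where
  "lid L R = near (lid_sites L R) (lid_offset L R) (ramp_slope L R / 4)"

section \<open>Positions of the sites of the lid\<close>

lemma ramp_slope_bounds:
  assumes "L + 5 \<le> R"
  shows "0 < ramp_slope L R" "ramp_slope L R \<le> 1/38"
  using assms by (auto simp: ramp_slope_def field_simps)

lemma ramp_slope_mult:
  assumes "L + 5 \<le> R" "k \<le> R - L + 12"
  shows "ramp_slope L R * of_int k + ramp_slope L R \<le> 1/2"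
proof -
  have "ramp_slope L R * (of_int k + 1) \<le> ramp_slope L R * of_int (R - L + 14)"
    using assms ramp_slope_bounds[of L R] by (intro mult_left_mono) linarith+
  also have "\<dots> = 1/2" using assms by (simp add: ramp_slope_def)
  finally show ?thesis by (simp add: algebra_simps)
qed

lemma lid_offset_bounds:
  assumes "L + 5 \<le> R" "w \<in> lid_sites L R"
  shows "\<bar>lid_offset L R w $ 1\<bar> + ramp_slope L R / 4 \<le> 1"
    and "\<bar>lid_offset L R w $ 2\<bar> + ramp_slope L R / 4 \<le> 1"
proof -
  note e = ramp_slope_bounds[OF assms(1)]
  show "\<bar>lid_offset L R w $ 1\<bar> + ramp_slope L R / 4 \<le> 1"
    using e by (auto simp: lid_offset_def)
  have k: "1 \<le> w $ 1 - L + 6" "w $ 1 - L + 6 \<le> R - L + 12"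
    using assms by (auto simp: lid_sites_def)
  have "ramp_slope L R * 1 \<le> ramp_slope L R * of_int (w $ 1 - L + 6)"
    using e k by (intro mult_left_mono) linarith+
  then show "\<bar>lid_offset L R w $ 2\<bar> + ramp_slope L R / 4 \<le> 1"
    using e ramp_slope_mult[OF assms(1) k(2)] by (auto simp: lid_offset_def)
qed

lemma lid_horiz:
  assumes "L + 5 \<le> R" "lid L R u" "w \<in> lid_sites L R"
  shows "\<bar>horiz u w - (of_int (w $ 1) + lid_offset L R w $ 1)\<bar> < ramp_slope L R / 4"
  using assms lid_offset_bounds[OF assms(1,3)] by (intro near_horiz) (auto simp: lid_def)

lemma lid_altitude:
  assumes "L + 5 \<le> R" "lid L R u" "w \<in> lid_sites L R"
  shows "\<bar>altitude u w - (of_int (w $ 2) + lid_offset L R w $ 2)\<bar> < ramp_slope L R / 4"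
  using assms lid_offset_bounds[OF assms(1,3)] by (intro near_altitude) (auto simp: lid_def)

text \<open>Continues the empty strips of the walls at \<open>L\<close> and \<open>R\<close> through
  row 10, so that the enclosure has closed sides up to the ramp.\<close>

lemma lid_row_10:
  assumes "L + 5 \<le> R" "lid L R u" "w \<in> lid_sites L R" "w $ 2 = 10"
  shows "altitude u w < 10"
    and "w $ 1 \<le> L \<Longrightarrow> horiz u w \<le> of_int L - 3/4"
    and "L < w $ 1 \<Longrightarrow> of_int L + 7/4 \<le> horiz u w"
    and "w $ 1 \<le> R \<Longrightarrow> horiz u w \<le> of_int R - 3/4"
    and "R < w $ 1 \<Longrightarrow> of_int R + 7/4 \<le> horiz u w"
proof -
  note e = ramp_slope_bounds[OF assms(1)]
  have x: "\<bar>horiz u w - (of_int (w $ 1) + lid_offset L R w $ 1)\<bar> < 1/8"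
    using lid_horiz[OF assms(1-3)] e by linarith
  have c: "lid_offset L R w $ 1 = (if w $ 1 \<le> L \<or> L + 2 < w $ 1 \<and> w $ 1 \<le> R then - 7/8 else 7/8)"
    using assms(4) by (simp add: lid_offset_def)
  show "altitude u w < 10"
  proof -
    have "lid_offset L R w $ 2 = - 1/2" using assms(4) by (simp add: lid_offset_def)
    then show ?thesis using lid_altitude[OF assms(1-3)] e assms(4) by linarith
  qed
  show "horiz u w \<le> of_int L - 3/4" if "w $ 1 \<le> L"
  proof -
    have "of_int (w $ 1) \<le> (of_int L :: real)" using that by simp
    moreover have "lid_offset L R w $ 1 = - 7/8" using that c by simp
    ultimately show ?thesis using x by linarith
  qed
  show "of_int L + 7/4 \<le> horiz u w" if "L < w $ 1"
  proof (cases "L + 2 < w $ 1 \<and> w $ 1 \<le> R")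
    case True
    then have "of_int L + 3 \<le> (of_int (w $ 1) :: real)" by linarith
    moreover have "- 7/8 \<le> lid_offset L R w $ 1" using c by simp
    ultimately show ?thesis using x by linarith
  next
    case False
    then have "lid_offset L R w $ 1 = 7/8" using that c by auto
    moreover have "of_int L + 1 \<le> (of_int (w $ 1) :: real)" using that by linarith
    ultimately show ?thesis using x by linarith
  qed
  show "horiz u w \<le> of_int R - 3/4" if "w $ 1 \<le> R"
  proof (cases "w $ 1 \<le> L \<or> L + 2 < w $ 1")
    case True
    then have "lid_offset L R w $ 1 = -7/8" using that c by auto
    moreover have "of_int (w $ 1) \<le> (of_int R :: real)" using that by simp
    ultimately show ?thesis using x by linarith
  next
    case False
    \<comment> \<open>Here \<open>w\<close> is in column \<open>L + 1\<close> or
      \<open>L + 2\<close>; pushed right, it stays clear of the gap at \<open>R\<close> since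
      \<open>L + 5\<close> is at most \<open>R\<close>.\<close>
    then have "w $ 1 \<le> R - 3" using assms(1) by linarith
    then have "of_int (w $ 1) \<le> (of_int R :: real) - 3" by linarith
    moreover have "lid_offset L R w $ 1 \<le> 7/8" using c by simp
    ultimately show ?thesis using x by linarith
  qed
  show "of_int R + 7/4 \<le> horiz u w" if "R < w $ 1"
  proof -
    have "of_int R + 1 \<le> (of_int (w $ 1) :: real)" using that by linarith
    moreover have "lid_offset L R w $ 1 = 7/8" using that c assms(1) by simp
    ultimately show ?thesis using x by linarith
  qed
qed

lemma lid_ramp:
  assumes "L + 5 \<le> R" "lid L R u" "w \<in> lid_sites L R" "w $ 2 = 11"
  shows "\<bar>horiz u w - of_int (w $ 1)\<bar> < ramp_slope L R / 4"
    and "\<bar>altitude u w - (10 + ramp_slope L R * of_int (w $ 1 - L + 6))\<bar> < ramp_slope L R / 4"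
    and "10 < altitude u w" "altitude u w < 21/2"
proof -
  note e = ramp_slope_bounds[OF assms(1)]
  show "\<bar>horiz u w - of_int (w $ 1)\<bar> < ramp_slope L R / 4"
    using lid_horiz[OF assms(1-3)] assms(4) by (simp add: lid_offset_def)
  show alt: "\<bar>altitude u w - (10 + ramp_slope L R * of_int (w $ 1 - L + 6))\<bar> < ramp_slope L R / 4"
    using lid_altitude[OF assms(1-3)] assms(4) by (simp add: lid_offset_def)
  have k: "1 \<le> w $ 1 - L + 6" "w $ 1 - L + 6 \<le> R - L + 12"
    using assms by (auto simp: lid_sites_def)
  have "ramp_slope L R * 1 \<le> ramp_slope L R * of_int (w $ 1 - L + 6)"
    using e k by (intro mult_left_mono) linarith+
  then show "10 < altitude u w" "altitude u w < 21/2"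
    using e ramp_slope_mult[OF assms(1) k(2)] alt by linarith+
qed

text \<open>With \<open>lid_below_ramp\<close>: within the columns of the lid, only row 11 has
  altitudes strictly between 10 and 12.\<close>

lemma lid_above_ramp:
  assumes "L + 5 \<le> R" "lid L R u" "L - 5 \<le> w $ 1" "w $ 1 \<le> R + 6" "12 \<le> w $ 2"
  shows "12 \<le> altitude u w"
proof (cases "w $ 2 = 12")
  case True
  then have "w \<in> lid_sites L R" using assms by (auto simp: lid_sites_def)
  moreover have "lid_offset L R w $ 2 = 1/2" using True by (simp add: lid_offset_def)
  ultimately show ?thesis
    using lid_altitude[OF assms(1,2), of w] True ramp_slope_bounds[OF assms(1)] by linarith
next
  case False
  then show ?thesis using assms(5) altitude_bounds[where w = w and u = u] by linarith
qed

lemma lid_below_ramp: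
  assumes "L + 5 \<le> R" "lid L R u" "L - 5 \<le> w $ 1" "w $ 1 \<le> R + 6" "w $ 2 \<le> 10"
  shows "altitude u w \<le> 10"
proof (cases "w $ 2 = 10")
  case True
  then have "w \<in> lid_sites L R" using assms by (auto simp: lid_sites_def)
  from lid_row_10(1)[OF assms(1,2) this True] show ?thesis by simp
next
  case False
  then show ?thesis using assms(5) altitude_bounds[where w = w and u = u] by linarith
qed

section \<open>Paths in the enclosure and along the ramp\<close>

definition cage :: "int \<Rightarrow> int \<Rightarrow> (int ^ 2) set" where
  "cage L R = {w. L < w $ 1 \<and> w $ 1 \<le> R \<and> -1 \<le> w $ 2 \<and> w $ 2 \<le> 10}"

lemma left_of_walled_lid:
  assumes "L + 5 \<le> R" "lid L R u" "wall K u" "K = L \<or> K = R"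
    "-1 \<le> w $ 2" "w $ 2 \<le> 10" "w $ 1 \<le> K" "L - 5 \<le> w $ 1"
  shows "horiz u w \<le> of_int K - 3/4"
proof (cases "w $ 2 = 10")
  case True
  then have "w \<in> lid_sites L R" using assms by (auto simp: lid_sites_def)
  then show ?thesis using lid_row_10(2,4)[OF assms(1,2)] True assms(4,7) by auto
qed (use assms wall_left in auto)

lemma right_of_walled_lid:
  assumes "L + 5 \<le> R" "lid L R u" "wall K u" "K = L \<or> K = R"
    "-1 \<le> w $ 2" "w $ 2 \<le> 10" "K < w $ 1" "w $ 1 \<le> R + 6"
  shows "of_int K + 7/4 \<le> horiz u w"
proof (cases "w $ 2 = 10")
  case True
  then have "w \<in> lid_sites L R" using assms by (auto simp: lid_sites_def)
  then show ?thesis using lid_row_10(3,5)[OF assms(1,2)] True assms(4,7) by auto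
qed (use assms wall_right in auto)

text \<open>The ramp site nearest to the column of \<open>v\<close> is always a candidate and bounds
  the length of the step. This forbids jumping over the ramp and, where the rungs of the walls end,
  crossing a side.\<close>

lemma cage_step:
  assumes LR: "L + 5 \<le> R" and lid: "lid L R u" and walls: "wall L u" "wall R u"
    and v: "v \<in> cage L R" "-1 \<le> altitude u v" and succ: "succ u v w"
  shows "w \<in> cage L R \<or> w $ 2 = 11 \<and> L - 1 \<le> w $ 1 \<and> w $ 1 \<le> R + 2"
proof -
  have v_row: "-1 \<le> v $ 2" "v $ 2 \<le> 10" and v_col: "L < v $ 1" "v $ 1 \<le> R"
    using v by (auto simp: cage_def)
  have xv: "of_int L + 7/4 \<le> horiz u v" "horiz u v \<le> of_int R - 3/4"
    using left_of_walled_lid[OF LR lid walls(2) _ v_row] right_of_walled_lid[OF LR lid walls(1) _ v_row]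
      v_col by auto
  have yv: "altitude u v \<le> 10"
    using lid_below_ramp[OF LR lid] v_row v_col by auto
  let ?s = "site (round (horiz u v)) 11"
  have round: "\<bar>of_int (round (horiz u v)) - horiz u v\<bar> \<le> 1/2"
    by (rule of_int_round_abs_le)
  have "L \<le> round (horiz u v)" "round (horiz u v) \<le> R" using round xv by linarith+
  then have s: "?s \<in> lid_sites L R" by (auto simp: lid_sites_def)
  note ramp = lid_ramp[OF LR lid s]
  have s_above: "altitude u v < altitude u ?s" using ramp yv by simp
  have "\<bar>horiz u ?s - of_int (round (horiz u v))\<bar> < ramp_slope L R / 4"
    using ramp(1) by simp
  then have "\<bar>horiz u ?s - horiz u v\<bar> \<le> 5/8"
    using round ramp_slope_bounds[OF LR] by linarith
  then have "gap u v ?s \<le> 5/8 + (21/2 - altitude u v)"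
    using ramp(4) s_above by (simp add: gap_def)
  then have gap: "gap u v w \<le> 5/8 + (21/2 - altitude u v)"
    using succ_gap_le[OF succ s_above] by simp
  have yw: "altitude u v < altitude u w" using succ by (rule succ_altitude)
  have right: False if "of_int R + 7/4 \<le> horiz u w"
  proof (cases "altitude u v < 35/4")
    case True
    then show False using wall_blocks_right[OF walls(2) succ xv(2) that v(2)] by simp
  next
    \<comment> \<open>Above 35/4 the candidate on the ramp has distance at most 5/8 + 21/2 - 35/4 =
      19/8, less than the width 5/2 of the strip.\<close>
    case False
    moreover have "5/2 \<le> gap u v w" using that xv unfolding gap_def by linarith
    ultimately show False using gap by simp
  qed
  have left: False if "horiz u w \<le> of_int L - 3/4"
  proof (cases "altitude u v < 35/4")
    case True
    then show False using wall_blocks_left[OF walls(1) succ xv(1) that v(2)] by simp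
  next
    case False
    moreover have "5/2 \<le> gap u v w" using that xv unfolding gap_def by linarith
    ultimately show False using gap by simp
  qed
  have col: "L - 2 < w $ 1" "w $ 1 < R + 3"
  proof -
    have "of_int L - 3/4 < horiz u w" "horiz u w < of_int R + 7/4"
      using left right not_le by blast+
    then show "L - 2 < w $ 1" "w $ 1 < R + 3"
      using horiz_bounds[where w = w and u = u] by linarith+
  qed
  have "w $ 2 < 12"
  proof (rule ccontr)
    assume "\<not> w $ 2 < 12"
    then have "12 \<le> altitude u w" using lid_above_ramp[OF LR lid, of w] col by simp
    then show False using gap yw unfolding gap_def by linarith
  qed
  moreover have row: "-1 \<le> w $ 2" using v(2) yw altitude_bounds[where w = w and u = u] by linarith
  moreover have "L < w $ 1 \<and> w $ 1 \<le> R" if "w $ 2 \<le> 10"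
    using left_of_walled_lid[OF LR lid walls(1) _ row that] left
      right_of_walled_lid[OF LR lid walls(2) _ row that] right col by force
  ultimately show ?thesis using col by (auto simp: cage_def)
qed

lemma finite_cage: "finite (cage L R)"
  unfolding cage_def
  by (rule finite_subset[OF _ finite_rectangle[of L R "-1" 10]]) auto

text \<open>Each step inside the finite cage leaves fewer cage sites above; the path must therefore
  exit, and by \<open>cage_step\<close> it exits onto the ramp.\<close>

lemma cage_to_ramp:
  assumes "no_ties u" "L + 5 \<le> R" "lid L R u" "wall L u" "wall R u"
    and "v \<in> cage L R" "-1 \<le> altitude u v"
  shows "\<exists>j. L - 1 \<le> j \<and> j \<le> R + 2 \<and> (succ u)\<^sup>*\<^sup>* v (site j 11)"
  using assms(6,7)
proof (induction "card {w \<in> cage L R. altitude u v < altitude u w}" arbitrary: v rule: less_induct)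
  case less
  obtain w where w: "succ u v w" using ex_succ[OF assms(1)] by blast
  note yw = succ_altitude[OF w]
  from cage_step[OF assms(2-5) less.prems w] show ?case
  proof
    assume cage: "w \<in> cage L R"
    have "{t \<in> cage L R. altitude u w < altitude u t} \<subset> {t \<in> cage L R. altitude u v < altitude u t}"
      using cage yw by auto
    then have "card {t \<in> cage L R. altitude u w < altitude u t}
        < card {t \<in> cage L R. altitude u v < altitude u t}"
      by (intro psubset_card_mono) (auto simp: finite_cage)
    from less.hyps[OF this cage] yw less.prems(2) obtain j where
      "L - 1 \<le> j \<and> j \<le> R + 2 \<and> (succ u)\<^sup>*\<^sup>* w (site j 11)" by auto
    with w show ?case by (meson converse_rtranclp_into_rtranclp)
  next
    assume *: "w $ 2 = 11 \<and> L - 1 \<le> w $ 1 \<and> w $ 1 \<le> R + 2"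
    then have "site (w $ 1) 11 = w" by (simp add: site_eq_iff)
    with * w show ?case by (intro exI[of _ "w $ 1"]) auto
  qed
qed

text \<open>The right neighbour is higher and at distance below 11/10. Rows up to 10 and the ramp
  further left are lower; row 12 and above, ramp sites two or more columns to the right, and columns
  at least 4 away are all at distance at least 3/2.\<close>

lemma ramp_step:
  assumes LR: "L + 5 \<le> R" and lid: "lid L R u" and j: "L - 1 \<le> j" "j \<le> R + 1"
  shows "succ u (site j 11) (site (j + 1) 11)"
proof -
  define e where "e = ramp_slope L R"
  have e: "0 < e" "e \<le> 1/38" using ramp_slope_bounds[OF LR] by (auto simp: e_def)
  let ?A = "site j 11" and ?B = "site (j + 1) 11"
  have "?A \<in> lid_sites L R" "?B \<in> lid_sites L R" using j by (auto simp: lid_sites_def)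
  note A = lid_ramp[OF LR lid this(1), folded e_def, unfolded vector_2, OF refl]
    and B = lid_ramp[OF LR lid this(2), folded e_def, unfolded vector_2, OF refl]
  have rise: "e * of_int (j + 1 - L + 6) = e * of_int (j - L + 6) + e"
    by (simp add: algebra_simps)
  have AB: "altitude u ?A < altitude u ?B" "altitude u ?B < altitude u ?A + 3/2 * e"
    using A(2) B(2) e(1) unfolding rise abs_less_iff by linarith+
  have "\<bar>horiz u ?B - horiz u ?A\<bar> \<le> 1 + e / 2"
    using A(1) B(1) by linarith
  then have gapAB: "gap u ?A ?B < 11/10"
    using e AB unfolding gap_def by linarith
  show ?thesis
    unfolding succ_def
  proof (intro conjI allI impI)
    show "altitude u ?A < altitude u ?B" by (rule AB(1))
    fix w assume w: "w \<noteq> ?B" "altitude u ?A < altitude u w"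
    have xgap: "\<bar>horiz u w - horiz u ?A\<bar> \<le> gap u ?A w" by (simp add: gap_def)
    show "gap u ?A ?B < gap u ?A w"
    proof (cases "\<bar>w $ 1 - j\<bar> \<ge> 4")
      case True
      then have "\<bar>real_of_int (w $ 1) - of_int j\<bar> \<ge> 4" by linarith
      then have "\<bar>horiz u w - horiz u ?A\<bar> \<ge> 2"
        using horiz_bounds[where w = w and u = u] A(1) e by linarith
      with gapAB xgap show ?thesis by simp
    next
      case False
      then have col: "L - 5 \<le> w $ 1" "w $ 1 \<le> R + 6" using j by auto
      have "\<not> w $ 2 \<le> 10" using lid_below_ramp[OF LR lid col] w(2) A(3) by auto
      then consider "w $ 2 = 11" | "12 \<le> w $ 2" by linarith
      then show ?thesis
      proof cases
        case 1
        then have "w \<in> lid_sites L R" using col by (auto simp: lid_sites_def)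
        note W = lid_ramp[OF LR lid this 1, folded e_def]
        have "j < w $ 1"
        proof (rule ccontr)
          assume "\<not> j < w $ 1"
          moreover have "w $ 1 \<noteq> j" using w(2) 1 site_eq_iff[of j 11 w] by auto
          ultimately have "w $ 1 - L + 6 \<le> j - L + 5" by linarith
          then have "e * of_int (w $ 1 - L + 6) \<le> e * of_int (j - L + 5)"
            using e by (intro mult_left_mono) linarith+
          also have "\<dots> = e * of_int (j - L + 6) - e" by (simp add: algebra_simps)
          finally show False using W(2) A(2) w(2) e unfolding abs_less_iff by linarith
        qed
        moreover have "w $ 1 \<noteq> j + 1" using w(1) 1 site_eq_iff[of "j + 1" 11 w] by auto
        ultimately have "real_of_int (w $ 1) - of_int j \<ge> 2" by linarith
        then have "\<bar>horiz u w - horiz u ?A\<bar> \<ge> 3/2"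
          using W(1) A(1) e unfolding abs_less_iff by linarith
        with gapAB xgap show ?thesis by simp
      next
        case 2
        then have "12 \<le> altitude u w" by (rule lid_above_ramp[OF LR lid col])
        then have "3/2 \<le> gap u ?A w" using A(4) unfolding gap_def by linarith
        with gapAB show ?thesis by simp
      qed
    qed
  qed
qed

lemma ramp_path:
  assumes "L + 5 \<le> R" "lid L R u" "L - 1 \<le> i" "i \<le> j" "j \<le> R + 2"
  shows "(succ u)\<^sup>*\<^sup>* (site i 11) (site j 11)"
  using assms(4,5)
proof (induction j rule: int_ge_induct)
  case (step j)
  then have "succ u (site j 11) (site (j + 1) 11)"
    using assms by (intro ramp_step[OF assms(1,2)]) auto
  with step show ?case by (auto intro: rtranclp.rtrancl_into_rtrancl)
qed simp

text \<open>Both paths reach the ramp and follow it to the column \<open>max i j\<close>. The wall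
  at \<open>K\<close> supplies the hypotheses of \<open>merging_paths\<close>, and immortality
  passes along the paths to the two parents.\<close>

lemma immortal_paths_merge:
  assumes u: "no_ties u" and LR: "L + 5 \<le> R" and lid: "lid L R u"
    and walls: "wall L u" "wall K u" "wall R u"
    and ab: "L < a" "a \<le> K" "K < b" "b \<le> R"
    and imm: "immortal u (site a 0)" "immortal u (site b 0)"
  shows "\<exists>z v w. v \<noteq> w \<and> succ u v z \<and> succ u w z \<and> immortal u v \<and> immortal u w"
proof -
  let ?a = "site a 0" and ?b = "site b 0"
  have low: "-1 \<le> altitude u ?a" "altitude u ?a \<le> 1" "-1 \<le> altitude u ?b" "altitude u ?b \<le> 1"
    using altitude_bounds[where w = ?a and u = u] altitude_bounds[where w = ?b and u = u] by auto
  have cage: "?a \<in> cage L R" "?b \<in> cage L R" using ab by (auto simp: cage_def)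
  obtain i where i: "L - 1 \<le> i" "i \<le> R + 2" "(succ u)\<^sup>*\<^sup>* ?a (site i 11)"
    using cage_to_ramp[OF u LR lid walls(1,3) cage(1) low(1)] by blast
  obtain j where j: "L - 1 \<le> j" "j \<le> R + 2" "(succ u)\<^sup>*\<^sup>* ?b (site j 11)"
    using cage_to_ramp[OF u LR lid walls(1,3) cage(2) low(3)] by blast
  have "(succ u)\<^sup>*\<^sup>* ?a (site (max i j) 11)" "(succ u)\<^sup>*\<^sup>* ?b (site (max i j) 11)"
    using i j ramp_path[OF LR lid i(1), of "max i j"] ramp_path[OF LR lid j(1), of "max i j"]
    by (meson max.cobounded1 max.cobounded2 max.bounded_iff rtranclp_trans)+
  moreover have "\<not> (succ u)\<^sup>*\<^sup>* ?a ?b" "\<not> (succ u)\<^sup>*\<^sup>* ?b ?a"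
    using wall_separates[OF walls(2) _ low(4), of ?a] wall_separates[OF walls(2) _ low(2), of ?b] ab
    by auto
  ultimately obtain z v w where "v \<noteq> w" "succ u v z" "succ u w z"
      "(succ u)\<^sup>*\<^sup>* ?a v" "(succ u)\<^sup>*\<^sup>* ?b w"
    using merging_paths[of "succ u" ?a "site (max i j) 11" ?b] by metis
  then show ?thesis using imm by (meson immortal_rtranclp)
qed

section \<open>The law of the configuration and mass transport\<close>

abbreviation offset_law :: "(real ^ 2) measure" where
  "offset_law \<equiv> uniform_measure lborel (cbox (\<chi> i. -1) (\<chi> i. 1))"

definition config_law :: "(int ^ 2 \<Rightarrow> real ^ 2) measure" where
  "config_law = PiM UNIV (\<lambda>_. offset_law)"

lemma open_positive_lborel:
  fixes S :: "'a :: euclidean_space set"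
  assumes "open S" "S \<noteq> {}"
  shows "0 < emeasure lborel S"
proof -
  have "S \<notin> null_sets lebesgue"
    using open_not_negligible[OF assms] by (simp add: negligible_iff_null_sets)
  then have "emeasure lborel S \<noteq> 0"
    using assms(1) by (auto simp: null_sets_def)
  then show ?thesis by (simp add: zero_less_iff_neq_zero)
qed

lemma emeasure_square_neq_0: "emeasure lborel (cbox (\<chi> i. -1) (\<chi> i. 1) :: (real ^ 2) set) \<noteq> 0"
proof -
  have "(\<chi> i. 0) \<in> box (\<chi> i. -1) (\<chi> i. 1 :: real ^ 2)"
    by (simp add: mem_box_cart)
  then have "0 < emeasure lborel (box (\<chi> i. -1) (\<chi> i. 1) :: (real ^ 2) set)"
    by (intro open_positive_lborel) auto
  also have "\<dots> \<le> emeasure lborel (cbox (\<chi> i. -1) (\<chi> i. 1) :: (real ^ 2) set)"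
    by (intro emeasure_mono box_subset_cbox) auto
  finally show ?thesis by simp
qed

lemma prob_space_offset_law: "prob_space offset_law"
  using emeasure_square_neq_0 emeasure_lborel_cbox_finite
  by (intro prob_space_uniform_measure) (auto simp: less_top[symmetric])

interpretation config: prob_space config_law
  unfolding config_law_def by (intro prob_space_PiM prob_space_offset_law)

section \<open>Measurability of the events\<close>

lemma space_config_law [simp]: "space config_law = UNIV"
  by (simp add: config_law_def space_PiM)

lemma measurable_component: "(\<lambda>u. u w) \<in> config_law \<rightarrow>\<^sub>M offset_law"
  unfolding config_law_def by (rule measurable_component_singleton) simp

lemma measurable_offset [measurable]: "(\<lambda>u. u w $ i) \<in> borel_measurable config_law"
proof -
  have "(\<lambda>t :: real ^ 2. t $ i) \<in> borel_measurable offset_law"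
    by simp
  from measurable_compose[OF measurable_component this] show ?thesis .
qed

lemma sets_Collect_config: "Measurable.pred config_law P \<Longrightarrow> {u. P u} \<in> sets config_law"
  by (simp add: pred_def)

lemma measurable_gap [measurable]:
  "(\<lambda>u. horiz u w) \<in> borel_measurable config_law"
  "(\<lambda>u. altitude u w) \<in> borel_measurable config_law"
  "(\<lambda>u. gap u v w) \<in> borel_measurable config_law"
  unfolding horiz_def altitude_def gap_def clip_def by measurable

lemma measurable_succ [measurable]: "Measurable.pred config_law (\<lambda>u. succ u v w)"
  unfolding succ_def by measurable

lemma measurable_no_ties [measurable]: "Measurable.pred config_law no_ties"
  unfolding no_ties_def[abs_def] neq_iff[where 'a = real] by measurable

lemma measurable_has_ancestor [measurable]: "Measurable.pred config_law (\<lambda>u. has_ancestor n u w)"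
  by (induction n arbitrary: w) simp_all

lemma measurable_immortal [measurable]: "Measurable.pred config_law (\<lambda>u. immortal u w)"
  unfolding immortal_def by measurable

lemma measurable_near [measurable]: "Measurable.pred config_law (near S c \<rho>)"
  unfolding near_def[abs_def] by measurable

lemma measurable_wall [measurable]: "Measurable.pred config_law (wall K)"
  unfolding wall_def by measurable

lemma measurable_lid [measurable]: "Measurable.pred config_law (lid L R)"
  unfolding lid_def by measurable

section \<open>Translation invariance\<close>

definition shift :: "int ^ 2 \<Rightarrow> (int ^ 2 \<Rightarrow> real ^ 2) \<Rightarrow> int ^ 2 \<Rightarrow> real ^ 2" where
  "shift a u w = u (w + a)"

lemma distr_shift: "distr config_law config_law (shift a) = config_law"
proof -
  have "distr (PiM UNIV (\<lambda>_. offset_law)) (\<Pi>\<^sub>M i\<in>UNIV. offset_law)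
      (\<lambda>\<omega>. \<lambda>n\<in>UNIV. \<omega> (n + a)) = (\<Pi>\<^sub>M i\<in>UNIV. offset_law)"
    by (rule distr_PiM_reindex[where f = "\<lambda>w. w + a" and K = UNIV and M = "\<lambda>_. offset_law"])
      (auto simp: prob_space_offset_law inj_on_def)
  then show ?thesis by (simp add: shift_def[abs_def] config_law_def restrict_UNIV)
qed

lemma measurable_shift [measurable]: "shift a \<in> config_law \<rightarrow>\<^sub>M config_law"
  unfolding shift_def[abs_def] using measurable_component
  by (subst (2) config_law_def, intro measurable_PiM_single') auto

lemma prob_shift:
  assumes [measurable]: "Measurable.pred config_law P"
  shows "config.prob {u. P (shift a u)} = config.prob {u. P u}"
proof -
  have "config.prob {u. P u} = measure (distr config_law config_law (shift a)) {u. P u}"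
    by (simp add: distr_shift)
  also have "\<dots> = config.prob (shift a -` {u. P u} \<inter> space config_law)"
    by (rule measure_distr) (auto intro!: sets_Collect_config)
  finally show ?thesis by (simp add: vimage_def)
qed

text \<open>Shifting the index translates all positions by \<open>- a\<close>; in comparisons of
  altitudes the constant cancels.\<close>

lemma gap_shift: "gap (shift a u) v w = gap u (v + a) (w + a)"
  "altitude (shift a u) w = altitude u (w + a) - of_int (a $ 2)"
  by (auto simp: gap_def horiz_def altitude_def shift_def)

lemma succ_shift: "succ (shift a u) v w \<longleftrightarrow> succ u (v + a) (w + a)"
proof -
  have "(\<forall>w'. w' \<noteq> w \<longrightarrow> altitude u (v + a) < altitude u (w' + a) \<longrightarrow>
        gap u (v + a) (w + a) < gap u (v + a) (w' + a)) \<longleftrightarrow>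
      (\<forall>w'. w' \<noteq> w + a \<longrightarrow> altitude u (v + a) < altitude u w' \<longrightarrow>
        gap u (v + a) (w + a) < gap u (v + a) w')"
    by (metis add_right_cancel diff_add_cancel)
  then show ?thesis by (simp add: succ_def gap_shift)
qed

lemma has_ancestor_shift: "has_ancestor n (shift a u) w \<longleftrightarrow> has_ancestor n u (w + a)"
proof (induction n arbitrary: w)
  case (Suc n)
  have "(\<exists>v. succ u (v + a) (w + a) \<and> has_ancestor n u (v + a)) \<longleftrightarrow>
      (\<exists>v. succ u v (w + a) \<and> has_ancestor n u v)"
    by (metis diff_add_cancel)
  then show ?case by (simp add: succ_shift Suc)
qed simp

lemma immortal_shift: "immortal (shift a u) w \<longleftrightarrow> immortal u (w + a)"
  by (simp add: immortal_def has_ancestor_shift)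

lemma wall_shift: "wall K (shift (site m 0) u) \<longleftrightarrow> wall (K + m) u"
proof -
  have *: "w \<in> wall_sites K \<longleftrightarrow> w + site m 0 \<in> wall_sites (K + m)" for w
    by (auto simp: wall_sites_def)
  have **: "wall_offset K w = wall_offset (K + m) (w + site m 0)" for w
    by (auto simp: wall_offset_def)
  have "wall K (shift (site m 0) u) \<longleftrightarrow> (\<forall>w. w + site m 0 \<in> wall_sites (K + m) \<longrightarrow>
      \<bar>u (w + site m 0) $ 1 - wall_offset (K + m) (w + site m 0) $ 1\<bar> < 1/8 \<and>
      \<bar>u (w + site m 0) $ 2 - wall_offset (K + m) (w + site m 0) $ 2\<bar> < 1/8)"
    unfolding wall_def near_def Ball_def * ** shift_def ..
  also have "\<dots> \<longleftrightarrow> wall (K + m) u"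
    unfolding wall_def near_def Ball_def by (metis diff_add_cancel)
  finally show ?thesis .
qed

text \<open>For fixed \<open>z\<close>, \<open>f\<close> counts the immortal parents of
  \<open>z\<close> and \<open>g\<close> indicates that \<open>z\<close> is immortal. Pointwise
  \<open>g\<close> is at most \<open>f\<close> by \<open>immortal_parent\<close>, while mass
  transport gives the reverse inequality for the expectations; hence \<open>f = g\<close> almost
  surely.\<close>

lemma AE_immortal_parent_unique:
  "AE u in config_law. \<forall>z v w. v \<noteq> w \<longrightarrow> succ u v z \<longrightarrow> succ u w z \<longrightarrow>
     \<not> (immortal u v \<and> immortal u w)"
proof -
  have "AE u in config_law. \<forall>v w. v \<noteq> w \<longrightarrow> succ u v z \<longrightarrow> succ u w z \<longrightarrow>
     \<not> (immortal u v \<and> immortal u w)" for z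
  proof -
    define f :: "_ \<Rightarrow> real" where
      "f u = (\<Sum>v\<in>nearby z. indicator {u. immortal u v \<and> succ u v z} u)" for u
    define g :: "_ \<Rightarrow> real" where
      "g u = indicator {u. immortal u z} u" for u
    have [measurable]: "{u. immortal u v \<and> succ u v w} \<in> sets config_law" for v w
    proof -
      have "Measurable.pred config_law (\<lambda>u. immortal u v \<and> succ u v w)" by measurable
      then show ?thesis by (simp add: pred_def)
    qed
    have [measurable]: "{u. immortal u v} \<in> sets config_law" for v
      using measurable_immortal[of v] by (simp add: pred_def)
    have int_f: "integrable config_law f" and int_g: "integrable config_law g"
      unfolding f_def g_def by (auto intro!: integrable_real_indicator simp: less_top[symmetric])
    \<comment> \<open>Mass transport: translation by \<open>z - v\<close> turns the mass that \<open>z\<close> receives from \<open>v\<close> into the mass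
      that \<open>z\<close> sends to the reflected site.\<close>
    have reflect: "bij_betw (\<lambda>v. z + z - v) (nearby z) (nearby z)"
      by (rule bij_betw_byWitness[where f' = "\<lambda>v. z + z - v"])
        (auto simp: nearby_def abs_minus_commute)
    have "integral\<^sup>L config_law f = (\<Sum>v\<in>nearby z. config.prob {u. immortal u v \<and> succ u v z})"
      unfolding f_def by (subst Bochner_Integration.integral_sum)
        (auto intro!: integrable_real_indicator simp: less_top[symmetric])
    also have "\<dots> = (\<Sum>v\<in>nearby z. config.prob {u. immortal u z \<and> succ u z (z + z - v)})"
    proof (rule sum.cong[OF refl])
      fix v
      show "config.prob {u. immortal u v \<and> succ u v z}
          = config.prob {u. immortal u z \<and> succ u z (z + z - v)}"
        using prob_shift[of "\<lambda>u. immortal u v \<and> succ u v z" "z - v"]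
        by (simp add: immortal_shift succ_shift algebra_simps)
    qed
    also have "\<dots> = (\<Sum>v\<in>nearby z. config.prob {u. immortal u z \<and> succ u z v})"
      by (rule sum.reindex_bij_betw[OF reflect])
    \<comment> \<open>Different targets of \<open>z\<close> give disjoint events by
      \<open>succ_unique\<close>.\<close>
    also have "\<dots> = config.prob (\<Union>v\<in>nearby z. {u. immortal u z \<and> succ u z v})"
      by (rule config.finite_measure_finite_Union[symmetric])
        (auto simp: finite_nearby disjoint_family_on_def dest: succ_unique)
    also have "\<dots> \<le> config.prob {u. immortal u z}"
      by (intro config.finite_measure_mono) auto
    also have "\<dots> = integral\<^sup>L config_law g"
      by (simp add: g_def[abs_def])
    finally have le: "integral\<^sup>L config_law f \<le> integral\<^sup>L config_law g" .
    have g_le_f: "g u \<le> f u" for u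
    proof (cases "immortal u z")
      case True
      then obtain v where v: "immortal u v" "succ u v z" using immortal_parent by blast
      then have "v \<in> nearby z" using succ_nearby nearby_sym by blast
      then have "indicator {u. immortal u v \<and> succ u v z} u \<le> f u"
        unfolding f_def by (intro member_le_sum) (auto simp: finite_nearby)
      then show ?thesis using v by (simp add: g_def indicator_def)
    qed (simp add: g_def f_def sum_nonneg)
    have "integral\<^sup>L config_law (\<lambda>u. f u - g u) = 0"
      using le integral_mono[OF int_g int_f g_le_f] by (simp add: int_f int_g)
    then have "AE u in config_law. f u - g u = 0"
      using g_le_f int_f int_g by (subst (asm) integral_nonneg_eq_0_iff_AE) auto
    then show ?thesis
    proof eventually_elim
      case (elim u)
      show ?case
      proof (intro allI impI notI)
        fix v w assume *: "v \<noteq> w" "succ u v z" "succ u w z" "immortal u v \<and> immortal u w"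
        then have sub: "{v, w} \<subseteq> nearby z" using succ_nearby nearby_sym by blast
        have "2 = (\<Sum>v\<in>{v, w}. indicator {u. immortal u v \<and> succ u v z} u :: real)"
          using * by simp
        also have "\<dots> \<le> f u"
          unfolding f_def using sub by (intro sum_mono2) (auto simp: finite_nearby)
        finally show False using elim by (cases "immortal u z") (auto simp: g_def)
      qed
    qed
  qed
  then show ?thesis by (simp add: AE_all_countable)
qed

section \<open>Independence, positivity and absence of ties\<close>

text \<open>Each event is a cylinder over the restriction of the configuration to its own
  coordinates, and restrictions to disjoint index sets are independent.\<close>

lemma prob_indep_coordinates:
  assumes [measurable]: "Measurable.pred config_law A" "Measurable.pred config_law B"
    and disj: "I \<inter> J = {}"
    and A: "\<And>u u'. (\<And>w. w \<in> I \<Longrightarrow> u w = u' w) \<Longrightarrow> A u \<longleftrightarrow> A u'"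
    and B: "\<And>u u'. (\<And>w. w \<in> J \<Longrightarrow> u w = u' w) \<Longrightarrow> B u \<longleftrightarrow> B u'"
  shows "config.prob {u. A u \<and> B u} = config.prob {u. A u} * config.prob {u. B u}"
proof -
  \<comment> \<open>Filling up with 0 lets \<open>A\<close> and \<open>B\<close> be evaluated on
    partial configurations.\<close>
  define ext :: "(int ^ 2) set \<Rightarrow> (int ^ 2 \<Rightarrow> real ^ 2) \<Rightarrow> int ^ 2 \<Rightarrow> real ^ 2" where
    "ext S x w = (if w \<in> S then x w else 0)" for S x w
  have ext_meas: "ext S \<in> PiM S (\<lambda>_. offset_law) \<rightarrow>\<^sub>M config_law" for S
    unfolding config_law_def
  proof (rule measurable_PiM_single')
    fix w show "(\<lambda>x. ext S x w) \<in> PiM S (\<lambda>_. offset_law) \<rightarrow>\<^sub>M offset_law"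
      unfolding ext_def by (cases "w \<in> S") (auto intro: measurable_component_singleton)
  qed (auto simp: space_PiM)
  have "config.indep_vars (\<lambda>_. offset_law) (\<lambda>w u. u w) UNIV"
  proof (subst config.indep_vars_iff_distr_eq_PiM')
    have "distr config_law offset_law (\<lambda>u. u w) = offset_law" for w
      unfolding config_law_def by (rule distr_PiM_component) (auto simp: prob_space_offset_law)
    moreover have "distr config_law config_law (\<lambda>u. u) = config_law"
      by (rule distr_id)
    ultimately show "distr config_law (Pi\<^sub>M UNIV (\<lambda>_. offset_law)) (\<lambda>x. \<lambda>i\<in>UNIV. x i) =
        Pi\<^sub>M UNIV (\<lambda>i. distr config_law offset_law (\<lambda>x. x i))"
      by (simp add: config_law_def restrict_UNIV)
  qed (auto intro: measurable_component)
  then have ind: "config.indep_var (PiM I (\<lambda>_. offset_law)) (\<lambda>u. restrict (\<lambda>w. u w) I)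
      (PiM J (\<lambda>_. offset_law)) (\<lambda>u. restrict (\<lambda>w. u w) J)"
    by (rule config.indep_var_restrict) (use disj in auto)
  define cyl where "cyl S P = {x \<in> space (PiM S (\<lambda>_. offset_law)). P (ext S x)}" for S P
  have cyl_sets: "cyl S P \<in> sets (PiM S (\<lambda>_. offset_law))" if "Measurable.pred config_law P" for S P
  proof -
    have "ext S -` {u. P u} \<inter> space (PiM S (\<lambda>_. offset_law)) \<in> sets (PiM S (\<lambda>_. offset_law))"
      by (rule measurable_sets[OF ext_meas]) (rule sets_Collect_config[OF that])
    then show ?thesis by (simp add: cyl_def vimage_def Int_def conj_commute)
  qed
  have cylA: "(\<lambda>w\<in>I. u w) \<in> cyl I A \<longleftrightarrow> A u" for u
    using A[of "ext I (\<lambda>w\<in>I. u w)" u] by (auto simp: cyl_def ext_def space_PiM)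
  have cylB: "(\<lambda>w\<in>J. u w) \<in> cyl J B \<longleftrightarrow> B u" for u
    using B[of "ext J (\<lambda>w\<in>J. u w)" u] by (auto simp: cyl_def ext_def space_PiM)
  from config.indep_varD[OF ind cyl_sets[OF assms(1)] cyl_sets[OF assms(2)]]
  show ?thesis by (simp add: vimage_def cylA cylB)
qed

lemma near_cong: "(\<And>w. w \<in> S \<Longrightarrow> u w = u' w) \<Longrightarrow> near S c \<rho> u \<longleftrightarrow> near S c \<rho> u'"
  by (auto simp: near_def)

text \<open>A finite product of masses of nonempty open boxes inside the square.\<close>

lemma prob_near_pos:
  assumes "finite S" "0 < \<rho>"
    and c: "\<And>w. w \<in> S \<Longrightarrow> \<bar>c w $ 1\<bar> + \<rho> \<le> 1 \<and> \<bar>c w $ 2\<bar> + \<rho> \<le> 1"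
  shows "0 < config.prob {u. near S c \<rho> u}"
proof -
  define X where "X w = {t :: real ^ 2. \<bar>t $ 1 - c w $ 1\<bar> < \<rho> \<and> \<bar>t $ 2 - c w $ 2\<bar> < \<rho>}" for w
  have open_X: "open (X w)" for w
    unfolding X_def by (intro open_Collect_conj open_Collect_less continuous_intros)
  have X_pos: "emeasure offset_law (X w) \<noteq> 0" if "w \<in> S" for w
  proof -
    have sub: "X w \<subseteq> cbox (\<chi> i. -1) (\<chi> i. 1)"
      using c[OF that] by (force simp: X_def mem_box_cart forall_2)
    have "c w \<in> X w" using assms(2) by (simp add: X_def)
    then have "0 < emeasure lborel (X w)" using open_X by (intro open_positive_lborel) auto
    then show ?thesis
      using sub emeasure_lborel_cbox_finite[of "\<chi> i. -1" "\<chi> i. 1 :: real ^ 2"] open_X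
      by (subst emeasure_uniform_measure)
        (auto simp: Int_absorb1 less_top[symmetric] ennreal_divide_eq_0_iff)
  qed
  interpret P: product_prob_space "\<lambda>_. offset_law" "UNIV :: (int ^ 2) set"
    by (intro product_prob_spaceI prob_space_offset_law)
  have "emeasure config_law {u \<in> space config_law. \<forall>w\<in>S. u w \<in> X w}
      = (\<Prod>w\<in>S. emeasure offset_law (X w))"
    unfolding config_law_def using assms(1) open_X by (intro P.emeasure_PiM_Collect) auto
  moreover have "(\<Prod>w\<in>S. emeasure offset_law (X w)) \<noteq> 0"
    using assms(1) X_pos by (simp add: prod_zero_iff)
  ultimately have "emeasure config_law {u. near S c \<rho> u} \<noteq> 0"
    by (simp add: near_def X_def)
  then show ?thesis
    by (simp add: config.emeasure_eq_measure zero_less_measure_iff)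
qed

section \<open>Positive probability of lids, almost sure existence of walls\<close>

lemma finite_wall_sites: "finite (wall_sites K)"
  unfolding wall_sites_def by (rule finite_rectangle)

lemma prob_wall_pos: "0 < config.prob {u. wall 0 u}"
  unfolding wall_def by (rule prob_near_pos) (auto simp: finite_wall_sites wall_offset_def)

lemma prob_lid_pos:
  assumes "L + 5 \<le> R"
  shows "0 < config.prob {u. lid L R u}"
  unfolding lid_def using assms ramp_slope_bounds[OF assms] lid_offset_bounds[OF assms]
  by (intro prob_near_pos) (auto simp: lid_sites_def finite_rectangle)

lemma prob_no_wall: "config.prob {u. \<not> wall K u} = 1 - config.prob {u. wall 0 u}"
proof -
  have "config.prob {u. wall K u} = config.prob {u. wall 0 u}"
    using prob_shift[OF measurable_wall[of 0], of "site K 0"] by (simp add: wall_shift)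
  then show ?thesis
    using config.prob_compl[OF sets_Collect_config[OF measurable_wall[of K]]]
    by (simp add: Compl_eq_Diff_UNIV[symmetric] Collect_neg_eq)
qed

text \<open>A wall occupies four columns, so walls at spacing 4 use disjoint coordinates and are
  independent.\<close>

lemma prob_no_walls:
  assumes "\<And>i j :: nat. i < j \<Longrightarrow> 4 \<le> \<bar>K i - K j\<bar>"
  shows "config.prob {u. \<forall>i<n. \<not> wall (K i) u} = (1 - config.prob {u. wall 0 u}) ^ n"
proof (induction n)
  case 0
  show ?case using config.prob_space by simp
next
  case (Suc n)
  have "config.prob {u. (\<forall>i<n. \<not> wall (K i) u) \<and> \<not> wall (K n) u}
      = config.prob {u. \<forall>i<n. \<not> wall (K i) u} * config.prob {u. \<not> wall (K n) u}"
  proof (rule prob_indep_coordinates[where I = "\<Union>i<n. wall_sites (K i)" and J = "wall_sites (K n)"])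
    show "(\<Union>i<n. wall_sites (K i)) \<inter> wall_sites (K n) = {}"
    proof -
      have "wall_sites (K i) \<inter> wall_sites (K n) = {}" if "i < n" for i
        using assms[OF that] by (auto simp: wall_sites_def)
      then show ?thesis by auto
    qed
    fix u u' :: "int ^ 2 \<Rightarrow> real ^ 2"
    show "(\<forall>i<n. \<not> wall (K i) u) \<longleftrightarrow> (\<forall>i<n. \<not> wall (K i) u')"
      if agree: "\<And>w. w \<in> (\<Union>i<n. wall_sites (K i)) \<Longrightarrow> u w = u' w"
    proof -
      have "wall (K i) u \<longleftrightarrow> wall (K i) u'" if "i < n" for i
        unfolding wall_def by (intro near_cong agree) (use that in auto)
      then show ?thesis by simp
    qed
    show "\<not> wall (K n) u \<longleftrightarrow> \<not> wall (K n) u'"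
      if "\<And>w. w \<in> wall_sites (K n) \<Longrightarrow> u w = u' w"
      using near_cong[OF that] unfolding wall_def by simp
  qed measurable
  moreover have "{u. \<forall>i<Suc n. \<not> wall (K i) u} = {u. (\<forall>i<n. \<not> wall (K i) u) \<and> \<not> wall (K n) u}"
    by (auto simp: less_Suc_eq)
  ultimately show ?case by (simp add: Suc prob_no_wall)
qed

lemma AE_ex_wall:
  assumes "\<And>i j :: nat. i < j \<Longrightarrow> 4 \<le> \<bar>K i - K j\<bar>"
  shows "AE u in config_law. \<exists>i. wall (K i) u"
proof -
  define b where "b = config.prob {u. wall 0 u}"
  have b: "0 < b" "b \<le> 1" using prob_wall_pos by (auto simp: b_def)
  have S: "{u. \<forall>i. \<not> wall (K i) u} \<in> sets config_law"
    by (rule sets_Collect_config) measurable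
  have S': "{u. \<forall>i<n. \<not> wall (K i) u} \<in> sets config_law" for n
    by (rule sets_Collect_config) measurable
  have "config.prob {u. \<forall>i. \<not> wall (K i) u} \<le> (1 - b) ^ n" for n
  proof -
    have "config.prob {u. \<forall>i. \<not> wall (K i) u} \<le> config.prob {u. \<forall>i<n. \<not> wall (K i) u}"
      by (rule config.finite_measure_mono) (auto simp: S')
    then show ?thesis by (simp only: prob_no_walls[OF assms] b_def)
  qed
  moreover have "(\<lambda>n. (1 - b) ^ n) \<longlonglongrightarrow> 0"
    using b by (intro LIMSEQ_power_zero) auto
  ultimately have "config.prob {u. \<forall>i. \<not> wall (K i) u} \<le> 0"
    by (intro LIMSEQ_le_const) auto
  then have "config.prob {u. \<forall>i. \<not> wall (K i) u} = 0"
    by (simp add: measure_le_0_iff)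
  then show ?thesis using config.prob_eq_0[OF S] by simp
qed

text \<open>If all pairs were almost surely disjoint, at most one event would occur, yet the
  expected number among the first \<open>n\<close> is at least \<open>n * q\<close>, which exceeds 1
  for large \<open>n\<close>. Applied to translates of one event, this takes the place of
  ergodicity.\<close>

lemma (in prob_space) ex_intersecting_events:
  fixes A :: "nat \<Rightarrow> 'a set"
  assumes [measurable]: "\<And>i. A i \<in> events" and "0 < q" "\<And>i. q \<le> prob (A i)"
  shows "\<exists>i j. i < j \<and> 0 < prob (A i \<inter> A j)"
proof (rule ccontr)
  assume "\<not> ?thesis"
  then have "prob (A i \<inter> A j) = 0" if "i < j" for i j
    using that by (auto simp: zero_less_measure_iff)
  then have "AE x in M. i < j \<longrightarrow> x \<notin> A i \<inter> A j" for i j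
    using prob_eq_0[of "A i \<inter> A j"] by (cases "i < j") auto
  then have disj: "AE x in M. \<forall>i j. i < j \<longrightarrow> x \<notin> A i \<inter> A j"
    by (simp add: AE_all_countable)
  obtain n where n: "1 < real n * q"
    using reals_Archimedean3[OF \<open>0 < q\<close>] by blast
  have "real n * q \<le> (\<Sum>i<n. prob (A i))"
    using sum_bounded_below[of "{..<n}" q "\<lambda>i. prob (A i)"] assms(3) by simp
  also have "\<dots> = expectation (\<lambda>x. \<Sum>i<n. indicator (A i) x)"
    by (subst Bochner_Integration.integral_sum)
      (auto intro!: integrable_real_indicator simp: less_top[symmetric])
  also have "\<dots> \<le> expectation (\<lambda>_. 1)"
  proof (rule integral_mono_AE)
    show "AE x in M. (\<Sum>i<n. indicator (A i) x) \<le> (1 :: real)"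
      using disj
    proof eventually_elim
      case (elim x)
      have "card {i \<in> {..<n}. x \<in> A i} \<le> Suc 0"
        using elim by (subst card_le_Suc0_iff_eq) (auto, metis linorder_neqE_nat IntI)
      moreover have "(\<Sum>i<n. indicator (A i) x) = real (card {i \<in> {..<n}. x \<in> A i})"
        by (simp add: indicator_def of_bool_def sum.If_cases Int_def)
      ultimately show ?case by simp
    qed
  qed (auto intro!: integrable_real_indicator simp: less_top[symmetric])
  also have "\<dots> = 1" using prob_space by simp
  finally show False using n by simp
qed

text \<open>The sphere is covered by the four lines that carry its sides.\<close>

lemma negligible_l1_sphere: "negligible {t :: real ^ 2. \<bar>t $ 1 - p\<bar> + \<bar>t $ 2 - q\<bar> = c}"
proof (rule negligible_subset)
  have neg: "negligible {t :: real ^ 2. vector [s, 1] \<bullet> t = d}" for s d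
    by (rule negligible_hyperplane) (auto simp: vec_eq_iff forall_2)
  let ?H = "\<lambda>s d. {t :: real ^ 2. vector [s, 1] \<bullet> t = d}"
  show "negligible (?H 1 (p + q + c) \<union> ?H 1 (p + q - c) \<union> ?H (-1) (q - p + c) \<union> ?H (-1) (q - p - c))"
    by (intro negligible_Un neg)
  show "{t. \<bar>t $ 1 - p\<bar> + \<bar>t $ 2 - q\<bar> = c}
      \<subseteq> ?H 1 (p + q + c) \<union> ?H 1 (p + q - c) \<union> ?H (-1) (q - p + c) \<union> ?H (-1) (q - p - c)"
    by (auto simp: inner_vec_def sum_2 abs_if split: if_splits)
qed

lemma AE_offset_law_l1_sphere: "AE t :: real ^ 2 in offset_law. \<bar>clip (t $ 1) - p\<bar> + \<bar>clip (t $ 2) - q\<bar> \<noteq> c"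
proof (rule AE_uniform_measureI)
  have "AE t in lebesgue. t \<notin> {t :: real ^ 2. \<bar>t $ 1 - p\<bar> + \<bar>t $ 2 - q\<bar> = c}"
    using negligible_l1_sphere[of p q c] unfolding negligible_iff_null_sets by (rule AE_not_in)
  then have "AE t in lborel. t \<notin> {t :: real ^ 2. \<bar>t $ 1 - p\<bar> + \<bar>t $ 2 - q\<bar> = c}"
    by (simp add: AE_completion_iff)
  then show "AE t :: real ^ 2 in lborel. t \<in> cbox (\<chi> i. -1) (\<chi> i. 1) \<longrightarrow>
      \<bar>clip (t $ 1) - p\<bar> + \<bar>clip (t $ 2) - q\<bar> \<noteq> c"
    by eventually_elim (auto simp: mem_box_cart clip_eq)
qed simp

text \<open>Fubini: freeze all displacements except that of \<open>w\<close>. A tie then forces the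
  displacement of \<open>w\<close> onto an l1 sphere, a null set.\<close>

lemma AE_gap_neq:
  assumes "v \<noteq> w" "v \<noteq> w'" "w \<noteq> w'"
  shows "AE u in config_law. gap u v w \<noteq> gap u v w'"
proof -
  let ?Q = "PiM (UNIV - {w}) (\<lambda>_. offset_law)" and ?h = "\<lambda>(t, u). u(w := t)"
  interpret Q: prob_space ?Q by (intro prob_space_PiM prob_space_offset_law)
  interpret O: prob_space offset_law by (rule prob_space_offset_law)
  interpret pair_sigma_finite offset_law ?Q ..
  have UNIV: "insert w (UNIV - {w}) = UNIV" by auto
  have h: "?h \<in> offset_law \<Otimes>\<^sub>M ?Q \<rightarrow>\<^sub>M config_law"
    using measurable_compose[OF measurable_pair_swap' measurable_add_dim[of w "UNIV - {w}" "\<lambda>_. offset_law"]]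
    unfolding config_law_def UNIV by (simp add: case_prod_beta)
  have law: "distr (offset_law \<Otimes>\<^sub>M ?Q) config_law ?h = config_law"
    using distr_pair_PiM_eq_PiM[of "UNIV - {w}" "\<lambda>_. offset_law" w]
    unfolding config_law_def UNIV by (simp add: prob_space_offset_law)
  have meas: "Measurable.pred config_law (\<lambda>u. gap u v w \<noteq> gap u v w')"
    unfolding neq_iff by measurable
  have set: "{x \<in> space (offset_law \<Otimes>\<^sub>M ?Q). gap (?h x) v w \<noteq> gap (?h x) v w'} \<in> sets (offset_law \<Otimes>\<^sub>M ?Q)"
    using measurable_compose[OF h meas] by (simp add: pred_def)
  have "AE t in offset_law. gap (u(w := t)) v w \<noteq> gap (u(w := t)) v w'" for u
  proof -
    \<comment> \<open>The centre is the position of \<open>v\<close> relative to the lattice point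
      of \<open>w\<close>, the radius the distance from \<open>v\<close> to \<open>w'\<close>;
      neither depends on \<open>t\<close>, as \<open>w\<close> differs from both.\<close>
    have "AE t in offset_law. \<bar>clip (t $ 1) - (horiz u v - of_int (w $ 1))\<bar> +
        \<bar>clip (t $ 2) - (altitude u v - of_int (w $ 2))\<bar> \<noteq> gap u v w'"
      by (rule AE_offset_law_l1_sphere)
    then show ?thesis
      by eventually_elim (use assms in \<open>auto simp: gap_def horiz_def altitude_def algebra_simps\<close>)
  qed
  then have "AE u in ?Q. AE t in offset_law. gap (?h (t, u)) v w \<noteq> gap (?h (t, u)) v w'"
    by simp
  then have "AE t in offset_law. AE u in ?Q. gap (?h (t, u)) v w \<noteq> gap (?h (t, u)) v w'"
    using set by (subst AE_commute) (auto simp: case_prod_beta)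
  then have "AE x in offset_law \<Otimes>\<^sub>M ?Q. gap (?h x) v w \<noteq> gap (?h x) v w'"
    by (intro AE_pair_measure[OF set])
  then have "AE u in distr (offset_law \<Otimes>\<^sub>M ?Q) config_law ?h. gap u v w \<noteq> gap u v w'"
    using sets_Collect_config[OF meas] by (subst AE_distr_iff[OF h]) auto
  then show ?thesis unfolding law .
qed

lemma AE_no_ties: "AE u in config_law. no_ties u"
  unfolding no_ties_def AE_all_countable
proof (intro allI)
  fix v w w' :: "int ^ 2"
  show "AE u in config_law. v \<noteq> w \<longrightarrow> v \<noteq> w' \<longrightarrow> w \<noteq> w' \<longrightarrow> gap u v w \<noteq> gap u v w'"
    using AE_gap_neq[of v w w'] by (cases "v \<noteq> w \<and> v \<noteq> w' \<and> w \<noteq> w'") auto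
qed

section \<open>Absence of bi-infinite paths\<close>

lemma AE_no_immortal_with_lid:
  assumes "L + 5 \<le> R" "L < a" "a \<le> K" "K < b" "b \<le> R"
  shows "AE u in config_law. \<not> (lid L R u \<and> wall L u \<and> wall K u \<and> wall R u \<and>
    immortal u (site a 0) \<and> immortal u (site b 0))"
  using AE_no_ties AE_immortal_parent_unique
  by eventually_elim (use immortal_paths_merge[OF _ assms(1) _ _ _ _ assms(2-5)] in blast)

text \<open>Were it positive, two translates of an immortal site between two walls would occur
  together with positive probability, and an independent lid over both would contradict
  \<open>AE_no_immortal_with_lid\<close>.\<close>

lemma prob_immortal: "config.prob {u. immortal u w} = 0"
proof -
  have "config.prob {u. immortal u (site 0 0)} = 0"
  proof (rule ccontr)
    assume pos: "config.prob {u. immortal u (site 0 0)} \<noteq> 0"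
    define S where "S l r u \<longleftrightarrow> immortal u (site 0 0) \<and> wall l u \<and> wall r u" for l r u
    have S_meas [measurable]: "Measurable.pred config_law (S l r)" for l r
      unfolding S_def[abs_def] by measurable
    \<comment> \<open>Almost surely walls exist on both sides; as there are countably many
      positions, some fixed pair has positive probability jointly with immortality.\<close>
    have "\<exists>i j :: nat. 0 < config.prob {u. S (- 10 - 4 * int i) (10 + 4 * int j) u}"
    proof (rule ccontr)
      assume "\<not> ?thesis"
      then have "config.prob {u. S (- 10 - 4 * int i) (10 + 4 * int j) u} = 0" for i j
        by (auto simp: zero_less_measure_iff)
      then have "AE u in config_law. \<not> S (- 10 - 4 * int i) (10 + 4 * int j) u" for i j
        using config.prob_eq_0[OF sets_Collect_config[OF S_meas[of "- 10 - 4 * int i" "10 + 4 * int j"]]] by simp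
      then have "AE u in config_law. \<forall>i j. \<not> S (- 10 - 4 * int i) (10 + 4 * int j) u"
        by (simp add: AE_all_countable)
      moreover have "AE u in config_law. \<exists>i. wall (- 10 - 4 * int i) u"
        by (rule AE_ex_wall) auto
      moreover have "AE u in config_law. \<exists>j. wall (10 + 4 * int j) u"
        by (rule AE_ex_wall) auto
      ultimately have "AE u in config_law. u \<notin> {u. immortal u (site 0 0)}"
        by eventually_elim (auto simp: S_def)
      then show False
        using pos config.prob_eq_0[OF sets_Collect_config[OF measurable_immortal]] by simp
    qed
    then obtain i j :: nat where ij: "0 < config.prob {u. S (- 10 - 4 * int i) (10 + 4 * int j) u}"
      by blast
    define l r where "l = - 10 - 4 * int i" and "r = 10 + 4 * int j"
    have lr: "l \<le> -10" "10 \<le> r" and S_pos: "0 < config.prob {u. S l r u}"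
      using ij by (simp_all add: l_def r_def)
    \<comment> \<open>A translation step longer than \<open>r - l\<close> puts the right wall of the
      earlier copy to the left of the immortal site of the later one.\<close>
    define m where "m = r - l + 1"
    define A where "A k u \<longleftrightarrow> S l r (shift (site (int k * m) 0) u)" for k :: nat and u
    have A_iff: "A k u \<longleftrightarrow> immortal u (site (int k * m) 0) \<and>
        wall (l + int k * m) u \<and> wall (r + int k * m) u" for k u
    proof -
      have "site 0 0 + site (int k * m) 0 = site (int k * m) 0"
        by (simp add: vec_eq_iff forall_2)
      then show ?thesis by (simp add: A_def S_def immortal_shift wall_shift)
    qed
    have A_meas [measurable]: "Measurable.pred config_law (A k)" for k
      unfolding A_iff[abs_def] by measurable
    have "config.prob {u. S l r u} \<le> config.prob {u. A k u}" for k
      unfolding A_def using prob_shift[OF S_meas] by simp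
    then obtain k k' where k: "k < k'" and A_pos: "0 < config.prob ({u. A k u} \<inter> {u. A k' u})"
      using config.ex_intersecting_events[OF sets_Collect_config[OF A_meas] S_pos] by blast
    define a b where "a = int k * m" and "b = int k' * m"
    have "a + m = (int k + 1) * m" by (simp add: a_def algebra_simps)
    also have "\<dots> \<le> b" unfolding b_def using k lr by (intro mult_right_mono) (auto simp: m_def)
    finally have ab: "a + r - l < b" by (simp add: m_def)
    let ?L = "l + a" and ?R = "r + b"
    have LR: "?L + 5 \<le> ?R" using ab lr by simp
    have "config.prob {u. (A k u \<and> A k' u) \<and> lid ?L ?R u}
        = config.prob {u. A k u \<and> A k' u} * config.prob {u. lid ?L ?R u}"
    \<comment> \<open>Immortality in row 0 and walls are decided by rows up to 9, the lid by rows 10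
      to 12.\<close>
    proof (rule prob_indep_coordinates[where I = "{w. w $ 2 \<le> 9}" and J = "lid_sites ?L ?R"])
      show "{w. w $ 2 \<le> 9} \<inter> lid_sites ?L ?R = {}" by (auto simp: lid_sites_def)
      fix u u' :: "int ^ 2 \<Rightarrow> real ^ 2"
      show "lid ?L ?R u \<longleftrightarrow> lid ?L ?R u'" if "\<And>w. w \<in> lid_sites ?L ?R \<Longrightarrow> u w = u' w"
        using near_cong[OF that] unfolding lid_def by simp
      assume agree: "\<And>w. w \<in> {w. w $ 2 \<le> 9} \<Longrightarrow> u w = u' w"
      have "wall K u \<longleftrightarrow> wall K u'" for K
        unfolding wall_def by (intro near_cong agree) (simp add: wall_sites_def)
      moreover have "immortal u (site i 0) \<longleftrightarrow> immortal u' (site i 0)" for i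
        by (rule immortal_rows_le[OF agree]) simp_all
      ultimately show "A k u \<and> A k' u \<longleftrightarrow> A k u' \<and> A k' u'" by (simp add: A_iff)
    qed measurable
    also have "\<dots> > 0"
      using A_pos prob_lid_pos[OF LR] by (simp add: Int_def)
    finally have pos: "0 < config.prob {u. (A k u \<and> A k' u) \<and> lid ?L ?R u}" .
    have "AE u in config_law. u \<notin> {u. (A k u \<and> A k' u) \<and> lid ?L ?R u}"
    proof -
      \<comment> \<open>The outer walls are the left one of the first copy and the right one of the
        second; the separating wall is the right one of the first copy, at
        \<open>r + a\<close>.\<close>
      have "AE u in config_law. \<not> (lid ?L ?R u \<and> wall ?L u \<and> wall (r + a) u \<and> wall ?R u \<and>
          immortal u (site a 0) \<and> immortal u (site b 0))"
        by (rule AE_no_immortal_with_lid[OF LR]) (use ab lr in simp_all)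
      then show ?thesis
        unfolding mem_Collect_eq A_iff a_def[symmetric] b_def[symmetric]
        by (rule eventually_mono) blast
    qed
    then show False
      using pos config.prob_eq_0[OF sets_Collect_config, of "\<lambda>u. (A k u \<and> A k' u) \<and> lid ?L ?R u"] by simp
  qed
  moreover have "site 0 0 + w = w" by (simp add: vec_eq_iff forall_2)
  moreover have "config.prob {u. immortal (shift w u) (site 0 0)} = config.prob {u. immortal u (site 0 0)}"
    by (rule prob_shift) measurable
  ultimately show ?thesis by (simp add: immortal_shift)
qed

lemma AE_no_immortal: "AE u in config_law. \<forall>w. \<not> immortal u w"
  unfolding AE_all_countable
  using config.prob_eq_0[OF sets_Collect_config[OF measurable_immortal]] prob_immortal by simp

lemma AE_in_square: "AE u in config_law. \<forall>w. u w \<in> cbox (\<chi> i. -1) (\<chi> i. 1)"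
  unfolding AE_all_countable config_law_def
proof
  fix w :: "int ^ 2"
  have "AE t :: real ^ 2 in offset_law. t \<in> cbox (\<chi> i. -1) (\<chi> i. 1)"
    by (rule AE_uniform_measureI) auto
  then show "AE u in PiM UNIV (\<lambda>_ :: int ^ 2. offset_law). u w \<in> cbox (\<chi> i. -1) (\<chi> i. 1)"
    by (intro AE_PiM_component) (auto simp: prob_space_offset_law)
qed

text \<open>Passes from points and \<open>ARG_MIN\<close> to sites and \<open>succ\<close>: distinct
  sites carry distinct vertices, so the path lifts to a chain of sites, each of which has ancestors
  of every order.\<close>

lemma no_bi_infinite_path:
  assumes u: "no_ties u" and square: "\<And>w. u w \<in> cbox (\<chi> i. -1) (\<chi> i. 1)"
    and mortal: "\<And>w. \<not> immortal u w"
  shows "\<not> bi_infinite_path (perturbed_lattice u) x"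
proof
  assume path: "bi_infinite_path (perturbed_lattice u) x"
  define pt where "pt w = lattice_point w + u w" for w
  have pt_nth: "pt w $ 1 = horiz u w" "pt w $ 2 = altitude u w" for w
    using square[of w]
    by (auto simp: pt_def lattice_point_def horiz_def altitude_def clip_eq mem_box_cart)
  have l1: "l1_norm (pt w - pt v) = gap u v w" for v w
    by (simp add: l1_norm_def sum_2 gap_def pt_nth)
  have V: "perturbed_lattice u = range pt"
    by (auto simp: perturbed_lattice_def pt_def)
  have pt_eq: "v = w" if "pt v = pt w" for v w
  proof (rule ccontr)
    assume "v \<noteq> w"
    \<comment> \<open>A third site, in a column beyond those of \<open>v\<close> and
      \<open>w\<close>: seen from it, coinciding vertices would be a tie.\<close>
    let ?s = "site (\<bar>v $ 1\<bar> + \<bar>w $ 1\<bar> + 1) 0"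
    have "?s \<noteq> v" "?s \<noteq> w" by (auto simp: site_eq_iff)
    moreover have "gap u ?s v = gap u ?s w" using that by (simp flip: l1)
    ultimately show False using u \<open>v \<noteq> w\<close> unfolding no_ties_def by blast
  qed
  have next_pt: "dsf_next (perturbed_lattice u) (pt v) = pt w" if "succ u v w" for v w
    unfolding dsf_next_def arg_min_def
  proof (rule some_equality)
    show "is_arg_min (\<lambda>y. l1_norm (y - pt v)) (\<lambda>y. y \<in> perturbed_lattice u \<and> pt v $ 2 < y $ 2) (pt w)"
      using that by (auto simp: is_arg_min_def V l1 pt_nth not_less succ_altitude intro: succ_gap_le)
    show "y = pt w"
      if y: "is_arg_min (\<lambda>y. l1_norm (y - pt v)) (\<lambda>y. y \<in> perturbed_lattice u \<and> pt v $ 2 < y $ 2) y" for y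
    proof -
      obtain w' where w': "y = pt w'" "altitude u v < altitude u w'"
        using y by (auto simp: is_arg_min_def V pt_nth)
      have "\<not> gap u v w < gap u v w'"
        using y succ_altitude[OF \<open>succ u v w\<close>] unfolding is_arg_min_def V w'(1)
        by (auto simp: l1 pt_nth)
      then show ?thesis using succ_eqI[OF \<open>succ u v w\<close> w'(2)] w'(1) by simp
    qed
  qed
  have "\<forall>k. \<exists>w. x k = pt w"
    using path by (auto simp: bi_infinite_path_def V)
  then obtain s where s: "\<And>k. x k = pt (s k)" by metis
  have step: "succ u (s k) (s (k + 1))" for k
  proof -
    obtain w where w: "succ u (s k) w" using ex_succ[OF u] by blast
    have "pt w = pt (s (k + 1))"
      using path next_pt[OF w] by (simp add: bi_infinite_path_def s)
    with w pt_eq show ?thesis by blast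
  qed
  have "has_ancestor n u (s k)" for n k
  proof (induction n arbitrary: k)
    case (Suc n)
    from step[of "k - 1"] Suc[of "k - 1"] show ?case by auto
  qed simp
  then show False using mortal[of "s 0"] by (simp add: immortal_def)
qed

theorem mainTheorem4:
  fixes M :: "'a measure" and U :: "int ^ 2 \<Rightarrow> 'a \<Rightarrow> real ^ 2"
  assumes "prob_space M"
    and "iid_uniform_perturbations M U"
  shows "AE \<omega> in M. \<not> (\<exists>x :: int \<Rightarrow> real ^ 2.
           bi_infinite_path (perturbed_lattice (\<lambda>w. U w \<omega>)) x)"
proof -
  interpret prob_space M by fact
  have indep: "indep_vars (\<lambda>_. borel) U UNIV"
    and law: "\<And>w. distr M borel (U w) = offset_law"
    using assms(2) by (auto simp: iid_uniform_perturbations_def)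
  have rv: "U w \<in> borel_measurable M" for w
    using indep by (auto simp: indep_vars_def)
  have meas: "(\<lambda>\<omega> w. U w \<omega>) \<in> M \<rightarrow>\<^sub>M PiM UNIV (\<lambda>_. borel)"
    by (rule measurable_PiM_single') (auto intro: rv)
  have "distr M (PiM UNIV (\<lambda>_. borel)) (\<lambda>\<omega>. \<lambda>w\<in>UNIV. U w \<omega>) = PiM UNIV (\<lambda>w. distr M borel (U w))"
    using indep by (rule indep_vars_iff_distr_eq_PiM'[THEN iffD1, rotated 2]) (simp_all add: rv)
  then have distr: "distr M (PiM UNIV (\<lambda>_. borel)) (\<lambda>\<omega> w. U w \<omega>) = config_law"
    by (simp only: law config_law_def restrict_UNIV)
  define good where "good u \<longleftrightarrow> no_ties u \<and> (\<forall>w. u w \<in> cbox (\<chi> i. -1) (\<chi> i. 1)) \<and>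
      (\<forall>w. \<not> immortal u w)" for u
  have "AE u in config_law. good u"
    using AE_no_ties AE_in_square AE_no_immortal by eventually_elim (simp add: good_def)
  \<comment> \<open>Only \<open>good\<close> is transferred between the laws; the absence of a path,
    a statement about uncountably many sequences, then follows pointwise.\<close>
  then have "AE \<omega> in M. good (\<lambda>w. U w \<omega>)"
    unfolding distr[symmetric] by (rule AE_distrD[OF meas])
  then show ?thesis
  proof eventually_elim
    case (elim \<omega>)
    then show ?case unfolding good_def using no_bi_infinite_path[of "\<lambda>w. U w \<omega>"] by blast
  qed
qed

end
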